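(* Let $\mathcal{S}$ be the (nonempty) set of all two-qubit states $\rho_{AB}$ with bit error rate $\mathrm{Tr}(\Pi^-\rho_{AB})=e_b$ and phase error rate $\mathrm{Tr}(\Pi_x^-\rho_{AB})=e_p$, where $e_b,e_p\in[0,1]$ are the values obtained in parameter estimation. In the symmetric case, the key rate of the BB84 QKD protocol is $$K_{BB84}=\min_{\rho_{AB}\in\mathcal{S}}C(\Phi(\rho_{AB}))-H(e_b)=1-H(e_p)-H(e_b).$$
   Context: States are density operators on $\mathbb{C}^2\otimes\mathbb{C}^2$; logarithms are base 2; $S(\rho)=-\mathrm{Tr}[\rho\log_2\rho]$; $H(e)=-e\log_2e-(1-e)\log_2(1-e)$. $|\pm\rangle=(|0\rangle\pm|1\rangle)/\sqrt2$. $\Pi^+=|00\rangle\langle00|+|11\rangle\langle11|$, $\Pi^-=|01\rangle\langle01|+|10\rangle\langle10|$, $\Pi_x^-=|{+-}\rangle\langle{+-}|+|{-+}\rangle\langle{-+}|$. $\Phi(\rho)=\Pi^+\rho\,\Pi^++\Pi^-\rho\,\Pi^-$. $C(\rho)=S(\rho^{\mathrm{diag}})-S(\rho)$ is the relative entropy of coherence in the reference basis $\{|00\rangle,|01\rangle,|10\rangle,|11\rangle\}$, with $\rho^{\mathrm{diag}}$ the diagonal part of $\rho$ in that basis. Key rate. Alice and Bob share i.i.d. copies of an unknown $\rho_{AB}\in\mathcal{S}$ (collective attacks, asymptotic limit) and generate key by measuring in the $Z$ basis $\{|0\rangle,|1\rangle\}$. In the symmetric case (evenly distributed raw key bits) the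 reconciliation cost is $H(e_b)$. For a state $\rho$ of $Q=AB$ with purification $|\psi\rangle_{QE}$, let $R(\rho)=S(Q|E)$ be the conditional entropy of the state $\sum_i|i\rangle\langle i|_Q\otimes\langle i|_Q|\psi\rangle\langle\psi|_{QE}|i\rangle_Q$ obtained by measuring $Q$ in the reference basis. With $\rho_{AB}^{\pm}=\Pi^{\pm}\rho_{AB}\Pi^{\pm}/\mathrm{Tr}(\Pi^{\pm}\rho_{AB})$ (terms of zero weight omitted) and $\sigma_x^B$ the bit flip on Bob's qubit, the key rate is $\min_{\rho_{AB}\in\mathcal{S}}\left[(1-e_b)R(\rho_{AB}^+)+e_bR(\sigma_x^B\rho_{AB}^-\sigma_x^B)\right]-H(e_b)$. *)

theory Defs
  imports Complex_Main "Jordan_Normal_Form.Schur_Decomposition"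
begin

subsection \<open>Linear algebra\<close>

definition mat_trace :: "complex mat \<Rightarrow> complex" where
  "mat_trace A = (\<Sum>i<dim_row A. A $$ (i, i))"

definition ketbra :: "complex vec \<Rightarrow> complex vec \<Rightarrow> complex mat" where
  "ketbra u v = mat (dim_vec u) (dim_vec v) (\<lambda>(i, j). u $ i * cnj (v $ j))"

text \<open>Bipartite spaces use the ordering of the Kronecker product: the basis vector
  \<open>|i\<rangle> \<otimes> |k\<rangle>\<close> of \<open>\<complex>\<^sup>m \<otimes> \<complex>\<^sup>n\<close> has index \<open>i * n + k\<close>.\<close>

definition tensor_vec :: "complex vec \<Rightarrow> complex vec \<Rightarrow> complex vec" where
  "tensor_vec u v = vec (dim_vec u * dim_vec v)
     (\<lambda>i. u $ (i div dim_vec v) * v $ (i mod dim_vec v))"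

definition tensor_mat :: "complex mat \<Rightarrow> complex mat \<Rightarrow> complex mat" where
  "tensor_mat A B = mat (dim_row A * dim_row B) (dim_col A * dim_col B)
     (\<lambda>(i, j). A $$ (i div dim_row B, j div dim_col B) * B $$ (i mod dim_row B, j mod dim_col B))"

definition partial_trace_fst :: "nat \<Rightarrow> nat \<Rightarrow> complex mat \<Rightarrow> complex mat" where
  "partial_trace_fst m n A = mat n n (\<lambda>(k, l). \<Sum>i<m. A $$ (i * n + k, i * n + l))"

definition partial_trace_snd :: "nat \<Rightarrow> nat \<Rightarrow> complex mat \<Rightarrow> complex mat" where
  "partial_trace_snd m n A = mat m m (\<lambda>(i, j). \<Sum>k<n. A $$ (i * n + k, j * n + k))"

text \<open>Functional calculus for Hermitian matrices: \<open>A = U diag(d) U\<^sup>\<dagger>\<close> is sent to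
  \<open>U diag(f \<circ> d) U\<^sup>\<dagger>\<close>, which does not depend on the chosen diagonalization.\<close>

definition hermitian_fun :: "(real \<Rightarrow> real) \<Rightarrow> complex mat \<Rightarrow> complex mat" where
  "hermitian_fun f A = (THE B. \<exists>U d. U \<in> carrier_mat (dim_row A) (dim_row A) \<and>
     U * mat_adjoint U = 1\<^sub>m (dim_row A) \<and>
     A = U * mat_diag (dim_row A) (\<lambda>i. complex_of_real (d i)) * mat_adjoint U \<and>
     B = U * mat_diag (dim_row A) (\<lambda>i. complex_of_real (f (d i))) * mat_adjoint U)"

subsection \<open>States and entropies\<close>

text \<open>The order on \<^typ>\<open>complex\<close> makes \<open>0 \<le> z\<close> say that \<open>z\<close> is real and nonnegative.\<close>

definition density_operator :: "nat \<Rightarrow> complex mat \<Rightarrow> bool" where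
  "density_operator n \<rho> \<longleftrightarrow> \<rho> \<in> carrier_mat n n \<and> mat_adjoint \<rho> = \<rho> \<and>
     (\<forall>v \<in> carrier_vec n. 0 \<le> (\<rho> *\<^sub>v v) \<bullet>c v) \<and> mat_trace \<rho> = 1"

text \<open>The value of the logarithm at \<open>0\<close> is immaterial below: the factor \<open>\<rho>\<close> vanishes
  on the kernel of \<open>\<rho>\<close>, which gives the convention \<open>0 log 0 = 0\<close>.\<close>

definition von_neumann_entropy :: "complex mat \<Rightarrow> real" where
  "von_neumann_entropy \<rho> = - Re (mat_trace (\<rho> * hermitian_fun (log 2) \<rho>))"

definition binary_entropy :: "real \<Rightarrow> real" where
  "binary_entropy e = - e * log 2 e - (1 - e) * log 2 (1 - e)"

definition diagonal_part :: "complex mat \<Rightarrow> complex mat" where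
  "diagonal_part \<rho> = mat_diag (dim_row \<rho>) (\<lambda>i. \<rho> $$ (i, i))"

definition coherence :: "complex mat \<Rightarrow> real" where
  "coherence \<rho> = von_neumann_entropy (diagonal_part \<rho>) - von_neumann_entropy \<rho>"

text \<open>\<open>S(Q|E) = S(QE) - S(E)\<close>, with \<open>Q\<close> the first factor, of dimension \<open>m\<close>.\<close>

definition conditional_entropy :: "nat \<Rightarrow> nat \<Rightarrow> complex mat \<Rightarrow> real" where
  "conditional_entropy m n \<sigma> =
     von_neumann_entropy \<sigma> - von_neumann_entropy (partial_trace_fst m n \<sigma>)"

definition purifies :: "nat \<Rightarrow> complex vec \<Rightarrow> complex mat \<Rightarrow> bool" where
  "purifies n \<psi> \<rho> \<longleftrightarrow> \<psi> \<in> carrier_vec (dim_row \<rho> * n) \<and>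
     partial_trace_snd (dim_row \<rho>) n (ketbra \<psi> \<psi>) = \<rho>"

text \<open>The unnormalized vector \<open>\<langle>i|\<^sub>Q |\<psi>\<rangle>\<^sub>Q\<^sub>E\<close> of \<open>E\<close>, where \<open>n\<close> is the dimension of \<open>E\<close>.\<close>

definition bra_fst :: "nat \<Rightarrow> nat \<Rightarrow> complex vec \<Rightarrow> complex vec" where
  "bra_fst n i \<psi> = vec n (\<lambda>k. \<psi> $ (i * n + k))"

text \<open>\<open>\<Sum>\<^sub>i |i\<rangle>\<langle>i| \<otimes> \<langle>i|\<psi>\<rangle>\<langle>\<psi>|i\<rangle>\<close>; the sum is taken entrywise because matrices of
  unspecified dimension do not form an additive monoid.\<close>

definition measured_state :: "nat \<Rightarrow> nat \<Rightarrow> complex vec \<Rightarrow> complex mat" where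
  "measured_state m n \<psi> = mat (m * n) (m * n) (\<lambda>rc. \<Sum>i<m.
     tensor_mat (ketbra (unit_vec m i) (unit_vec m i))
       (ketbra (bra_fst n i \<psi>) (bra_fst n i \<psi>)) $$ rc)"

text \<open>The value is the same for all purifications, with \<open>E\<close> of any finite dimension.\<close>

definition randomness :: "complex mat \<Rightarrow> real" where
  "randomness \<rho> = (THE r. \<exists>n \<psi>. purifies n \<psi> \<rho> \<and>
     r = conditional_entropy (dim_row \<rho>) n (measured_state (dim_row \<rho>) n \<psi>))"

subsection \<open>Two-qubit protocol\<close>

definition ket0 :: "complex vec" where "ket0 = unit_vec 2 0"
definition ket1 :: "complex vec" where "ket1 = unit_vec 2 1"
definition ket_plus :: "complex vec" where
  "ket_plus = complex_of_real (1 / sqrt 2) \<cdot>\<^sub>v (ket0 + ket1)"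
definition ket_minus :: "complex vec" where
  "ket_minus = complex_of_real (1 / sqrt 2) \<cdot>\<^sub>v (ket0 - ket1)"

definition proj2 :: "complex vec \<Rightarrow> complex vec \<Rightarrow> complex mat" where
  "proj2 u v = ketbra (tensor_vec u v) (tensor_vec u v)"

definition Pi_plus :: "complex mat" where
  "Pi_plus = proj2 ket0 ket0 + proj2 ket1 ket1"
definition Pi_minus :: "complex mat" where
  "Pi_minus = proj2 ket0 ket1 + proj2 ket1 ket0"
definition Pi_x_minus :: "complex mat" where
  "Pi_x_minus = proj2 ket_plus ket_minus + proj2 ket_minus ket_plus"

definition Phi :: "complex mat \<Rightarrow> complex mat" where
  "Phi \<rho> = Pi_plus * \<rho> * Pi_plus + Pi_minus * \<rho> * Pi_minus"

definition post_state :: "complex mat \<Rightarrow> complex mat \<Rightarrow> complex mat" where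
  "post_state P \<rho> = (1 / mat_trace (P * \<rho>)) \<cdot>\<^sub>m (P * \<rho> * P)"

definition flip_B :: "complex mat" where
  "flip_B = tensor_mat (1\<^sub>m 2) (ketbra ket0 ket1 + ketbra ket1 ket0)"

text \<open>\<open>LEAST\<close> is the minimum only if it is attained; \<open>has_minimum\<close> states that it is.\<close>

definition has_minimum :: "('a \<Rightarrow> real) \<Rightarrow> 'a set \<Rightarrow> bool" where
  "has_minimum f A \<longleftrightarrow> (\<exists>x\<in>A. \<forall>y\<in>A. f x \<le> f y)"

definition minimum :: "('a \<Rightarrow> real) \<Rightarrow> 'a set \<Rightarrow> real" where
  "minimum f A = (LEAST r. r \<in> f ` A)"

text \<open>The weights \<open>1 - e\<^sub>b\<close> and \<open>e\<^sub>b\<close> are the traces of \<open>\<Pi>\<^sup>\<plusminus>\<rho>\<close>, so a term whose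
  conditional state is undefined is multiplied by \<open>0\<close> and drops out.\<close>

definition sifted_randomness :: "real \<Rightarrow> complex mat \<Rightarrow> real" where
  "sifted_randomness e\<^sub>b \<rho> = (1 - e\<^sub>b) * randomness (post_state Pi_plus \<rho>)
     + e\<^sub>b * randomness (flip_B * post_state Pi_minus \<rho> * flip_B)"

definition key_rate :: "complex mat set \<Rightarrow> real \<Rightarrow> real" where
  "key_rate \<S> e\<^sub>b = minimum (sifted_randomness e\<^sub>b) \<S> - binary_entropy e\<^sub>b"

definition bb84_states :: "real \<Rightarrow> real \<Rightarrow> complex mat set" where
  "bb84_states e\<^sub>b e\<^sub>p = {\<rho>. density_operator 4 \<rho> \<and>
     mat_trace (Pi_minus * \<rho>) = complex_of_real e\<^sub>b \<and>
     mat_trace (Pi_x_minus * \<rho>) = complex_of_real e\<^sub>p}"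

end

theory Submission
  imports Defs
begin

text \<open>For every purification, \<open>R(\<rho>)\<close> equals \<open>C(\<rho>)\<close>: the measured state is \<open>W W\<^sup>\<dagger>\<close> with
  \<open>W\<^sup>\<dagger> W = \<rho>\<^sup>d\<^sup>i\<^sup>a\<^sup>g\<close>, the state of \<open>E\<close> is \<open>N N\<^sup>\<dagger>\<close> with \<open>N\<^sup>\<dagger> N = \<rho>\<^sup>T\<close>, and \<open>M M\<^sup>\<dagger>\<close> and \<open>M\<^sup>\<dagger> M\<close>
  have the same entropy. The state \<open>\<Phi>(\<rho>)\<close> consists of two \<open>2 \<times> 2\<close> blocks, on \<open>{00, 11}\<close> and on \<open>{01, 10}\<close>, and
  its coherence is the sum of the homogeneous coherences of the blocks, which are the two terms of the
  key rate. The error rates say that the blocks have traces \<open>1 - e\<^sub>b\<close>, \<open>e\<^sub>b\<close> and that the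
  real parts of their off-diagonal entries \<open>c\<close>, \<open>q\<close> satisfy \<open>2 Re c + 2 Re q = 1 - 2 e\<^sub>p\<close>.
  A block with Bloch components \<open>\<delta>\<close>, \<open>\<tau>\<close> along \<open>z\<close>, \<open>x\<close> has coherence at least \<open>1 - H((1 + \<tau>) / 2)\<close>, because
  \<open>1 - H((1 + s) / 2)\<close> divided by \<open>s\<^sup>2\<close> is nondecreasing, hence superadditive as a function of \<open>s\<^sup>2\<close>;
  the log-sum inequality then combines the two blocks. Equality holds for the Bell-diagonal state with
  independent bit and phase errors.\<close>

section \<open>Unitary diagonalization\<close>

lemma adjoint_dim [simp]:
  "dim_row (mat_adjoint A) = dim_col A" "dim_col (mat_adjoint A) = dim_row A"
  by (simp_all add: mat_adjoint_def)

lemma adjoint_carrier [simp]: "A \<in> carrier_mat m n \<Longrightarrow> mat_adjoint A \<in> carrier_mat n m"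
  by (intro carrier_matI) simp_all

lemma index_adjoint [simp]:
  fixes A :: "complex mat"
  assumes "i < dim_col A" "j < dim_row A"
  shows "mat_adjoint A $$ (i, j) = cnj (A $$ (j, i))"
  using assms by (simp add: mat_adjoint_def mat_of_rows_def conjugate_complex_def)

lemma adjoint_adjoint [simp]: "mat_adjoint (mat_adjoint A) = (A :: complex mat)"
  by (rule eq_matI) auto

lemma index_mult_sum:
  assumes "i < dim_row A" "j < dim_col B" "dim_col A = k" "dim_row B = k"
  shows "(A * B) $$ (i, j) = (\<Sum>l<k. A $$ (i, l) * B $$ (l, j))"
  using assms by (simp add: scalar_prod_def atLeast0LessThan)

text \<open>The premises are dimension equations, so as a rewrite rule this associates long products
  to the right once the simplifier knows the dimensions.\<close>

lemma mult_mat_assoc: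
  "dim_col A = dim_row B \<Longrightarrow> dim_col B = dim_row C \<Longrightarrow> (A * B) * C = A * (B * C)"
  by (rule assoc_mult_mat[of A "dim_row A" "dim_row B" B "dim_row C" C "dim_col C"]) auto

lemma mult_mat_cancel:
  fixes A B X :: "'a :: semiring_1 mat"
  assumes "A * B = 1\<^sub>m n" "dim_col A = dim_row B" "dim_col B = n" "dim_row X = n"
  shows "A * (B * X) = X"
proof -
  have "A * (B * X) = 1\<^sub>m n * X" using assms mult_mat_assoc[of A B X] by simp
  then show ?thesis by (simp only: left_mult_one_mat[OF carrier_matI[OF assms(4) refl]])
qed

lemma adjoint_mult:
  fixes A B :: "complex mat"
  assumes "A \<in> carrier_mat m k" "B \<in> carrier_mat k n"
  shows "mat_adjoint (A * B) = mat_adjoint B * mat_adjoint A"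
  using assms by (intro eq_matI) (auto simp: index_mult_sum[where k = k] mult.commute simp del: index_mult_mat(1))

lemma adjoint_one [simp]: "mat_adjoint (1\<^sub>m n :: complex mat) = 1\<^sub>m n"
  by (rule eq_matI) auto

text \<open>Gram-Schmidt on a basis starting with \<open>v\<close> keeps the first vector; dividing
  the resulting orthogonal vectors by their norms gives the columns of \<open>W\<close>.\<close>

lemma unitary_completion:
  fixes v :: "complex vec"
  assumes v: "v \<in> carrier_vec n" "v \<noteq> 0\<^sub>v n"
  obtains W c where "W \<in> carrier_mat n n" "mat_adjoint W * W = 1\<^sub>m n" "W * mat_adjoint W = 1\<^sub>m n"
    "col W 0 = c \<cdot>\<^sub>v v"
proof -
  interpret cof_vec_space n "TYPE(complex)" .
  define b where "b = basis_completion v"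
  define ws where "ws = gram_schmidt n b"
  note b = basis_completion[OF v, folded b_def]
  have n: "n \<noteq> 0" using v by (auto intro: eq_vecI)
  obtain vs where bv: "b = v # vs" using b(6,7) n by (cases b) auto
  note gs = gram_schmidt_result[OF b(2,4,5) refl, folded ws_def]
  have len: "length ws = n" using gs(4) b(6) by simp
  have hd: "hd ws = v" using gram_schmidt_hd[OF v(1), of vs, folded bv] by (simp add: ws_def)
  have ws0: "ws ! 0 = v" using hd hd_conv_nth[of ws] len n by (cases ws) auto
  have wc: "ws ! i \<in> carrier_vec n" if "i < n" for i
    using gs(3) len that nth_mem by blast
  define r where "r i = sqrt (Re (ws ! i \<bullet>c ws ! i))" for i
  define W where "W = mat n n (\<lambda>(i, j). ws ! j $ i / complex_of_real (r j))"
  have W: "W \<in> carrier_mat n n" by (simp add: W_def)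
  have nn: "ws ! i \<bullet>c ws ! i = (complex_of_real (r i))\<^sup>2" "r i \<noteq> 0" if "i < n" for i
  proof -
    have "ws ! i \<bullet>c ws ! i \<noteq> 0" using gs(2) that len by (auto simp: corthogonal_def)
    moreover have "0 \<le> ws ! i \<bullet>c ws ! i" using conjugate_square_ge_0_vec by auto
    ultimately have re: "0 < Re (ws ! i \<bullet>c ws ! i)" "Im (ws ! i \<bullet>c ws ! i) = 0"
      by (auto simp: less_eq_complex_def complex_eq_iff)
    then show "ws ! i \<bullet>c ws ! i = (complex_of_real (r i))\<^sup>2" "r i \<noteq> 0"
      by (auto simp: r_def complex_eq_iff simp flip: of_real_power)
  qed
  have ww: "mat_adjoint W * W = 1\<^sub>m n"
  proof (rule eq_matI)
    fix i j assume ij: "i < dim_row (1\<^sub>m n :: complex mat)" "j < dim_col (1\<^sub>m n :: complex mat)"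
    then have "(mat_adjoint W * W) $$ (i, j) = (\<Sum>l<n. cnj (W $$ (l, i)) * W $$ (l, j))"
      using W by (subst index_mult_sum[where k = n]) auto
    also have "\<dots> = (\<Sum>l<n. ws ! j $ l * cnj (ws ! i $ l)) / (complex_of_real (r i) * complex_of_real (r j))"
      using ij by (simp add: W_def sum_divide_distrib mult.commute)
    also have "(\<Sum>l<n. ws ! j $ l * cnj (ws ! i $ l)) = ws ! j \<bullet>c ws ! i"
      using ij carrier_vecD[OF wc[of i]] by (auto simp: scalar_prod_def conjugate_complex_def atLeast0LessThan intro!: sum.cong)
    also have "ws ! j \<bullet>c ws ! i = (if i = j then (complex_of_real (r i))\<^sup>2 else 0)"
      using ij nn(1) gs(2) len by (auto simp: corthogonal_def)
    finally show "(mat_adjoint W * W) $$ (i, j) = 1\<^sub>m n $$ (i, j)"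
      using ij nn(2) by (auto simp: power2_eq_square)
  qed (use W in auto)
  have "W * mat_adjoint W = 1\<^sub>m n"
    using mat_mult_left_right_inverse[OF adjoint_carrier[OF W] W ww] .
  moreover have "col W 0 = (1 / complex_of_real (r 0)) \<cdot>\<^sub>v v"
    using n v(1) ws0 by (intro eq_vecI) (auto simp: W_def)
  ultimately show ?thesis using that W ww by blast
qed

text \<open>The condition inside the description in \<open>hermitian_fun\<close>, with the dimension
  as a parameter.\<close>

definition diagonalizes :: "nat \<Rightarrow> complex mat \<Rightarrow> (nat \<Rightarrow> real) \<Rightarrow> complex mat \<Rightarrow> bool" where
  "diagonalizes n U d A \<longleftrightarrow> U \<in> carrier_mat n n \<and> U * mat_adjoint U = 1\<^sub>m n \<and>
     A = U * mat_diag n (\<lambda>i. complex_of_real (d i)) * mat_adjoint U"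

lemma dim_mat_diag [simp]: "dim_row (mat_diag n f) = n" "dim_col (mat_diag n f) = n"
  by (simp_all add: mat_diag_def)

text \<open>The direct sum of the scalar \<open>c\<close> and \<open>X\<close>, which carries the
  spectral theorem from dimension \<open>m\<close> to \<open>Suc m\<close>.\<close>

definition bordered :: "complex \<Rightarrow> complex mat \<Rightarrow> complex mat" where
  "bordered c X = mat (Suc (dim_row X)) (Suc (dim_col X))
     (\<lambda>(i, j). if i = 0 \<and> j = 0 then c else if i = 0 \<or> j = 0 then 0 else X $$ (i - 1, j - 1))"

lemma bordered_carrier [simp]: "X \<in> carrier_mat m n \<Longrightarrow> bordered c X \<in> carrier_mat (Suc m) (Suc n)"
  unfolding bordered_def by (intro carrier_matI) simp_all

lemma bordered_adjoint: "mat_adjoint (bordered c X) = bordered (cnj c) (mat_adjoint X)"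
  by (rule eq_matI) (auto simp: bordered_def)

lemma bordered_one: "bordered 1 (1\<^sub>m m) = 1\<^sub>m (Suc m)"
  by (rule eq_matI) (auto simp: bordered_def)

lemma bordered_mult:
  assumes "X \<in> carrier_mat m n" "Y \<in> carrier_mat n k"
  shows "bordered c X * bordered d Y = bordered (c * d) (X * Y)"
proof (rule eq_matI)
  note [simp] = carrier_matD[OF assms(1)] carrier_matD[OF assms(2)]
  fix i j assume ij: "i < dim_row (bordered (c * d) (X * Y))" "j < dim_col (bordered (c * d) (X * Y))"
  then have "(bordered c X * bordered d Y) $$ (i, j)
      = (\<Sum>l<Suc n. bordered c X $$ (i, l) * bordered d Y $$ (l, j))"
    by (subst index_mult_sum[where k = "Suc n"]) (auto simp: bordered_def)
  also have "\<dots> = bordered (c * d) (X * Y) $$ (i, j)"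
    using ij unfolding sum.lessThan_Suc_shift
    by (auto simp: bordered_def index_mult_sum[where k = n] simp del: index_mult_mat(1))
  finally show "(bordered c X * bordered d Y) $$ (i, j) = bordered (c * d) (X * Y) $$ (i, j)" .
qed (use assms in \<open>auto simp: bordered_def\<close>)

text \<open>Induction on the dimension: in an orthonormal basis whose first vector is an
  eigenvector, a Hermitian matrix is the direct sum of the eigenvalue and a smaller Hermitian
  matrix.\<close>

lemma spectral_theorem:
  assumes "A \<in> carrier_mat n n" "mat_adjoint A = A"
  obtains U d where "diagonalizes n U d A"
proof -
  have "\<exists>U d. diagonalizes n U d A" using assms
  proof (induction n arbitrary: A)
    case 0
    then have "diagonalizes 0 (1\<^sub>m 0) (\<lambda>_. 0) A"
      by (auto simp: diagonalizes_def intro!: eq_matI)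
    then show ?case by blast
  next
    case (Suc m)
    note A = Suc.prems(1) and H = Suc.prems(2)
    obtain e as where "char_poly A = (\<Prod>a\<leftarrow>e # as. [:- a, 1:])"
      using char_poly_factorized[OF A] by (metis length_Suc_conv)
    then have "poly (char_poly A) e = 0" by simp
    then have "eigenvalue A e" using eigenvalue_root_char_poly[OF A] by simp
    then obtain v where v: "v \<in> carrier_vec (Suc m)" "v \<noteq> 0\<^sub>v (Suc m)" "A *\<^sub>v v = e \<cdot>\<^sub>v v"
      using A by (auto simp: eigenvalue_def eigenvector_def)
    obtain W c where W: "W \<in> carrier_mat (Suc m) (Suc m)" "mat_adjoint W * W = 1\<^sub>m (Suc m)"
      "W * mat_adjoint W = 1\<^sub>m (Suc m)" "col W 0 = c \<cdot>\<^sub>v v"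
      using unitary_completion[OF v(1,2)] by blast
    have Wa: "mat_adjoint W \<in> carrier_mat (Suc m) (Suc m)" using W(1) by simp
    define B where "B = mat_adjoint W * A * W"
    have B: "B \<in> carrier_mat (Suc m) (Suc m)" using W(1) Wa A unfolding B_def by (intro mult_carrier_mat)
    have BH: "mat_adjoint B = B"
      unfolding B_def using W(1) Wa A H
      by (simp add: adjoint_mult[of _ "Suc m" "Suc m" _ "Suc m"] mult_carrier_mat[of _ "Suc m" "Suc m"]
          mult_mat_assoc del: assoc_mult_mat)
    have AB: "A = W * B * mat_adjoint W"
    proof -
      have "W * B * mat_adjoint W = A * (W * mat_adjoint W)"
        using W(1) A by (simp add: B_def mult_mat_assoc mult_mat_cancel[OF W(3)] del: assoc_mult_mat)
      then show ?thesis using A by (simp add: W(3))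
    qed
    have "A *\<^sub>v col W 0 = e \<cdot>\<^sub>v col W 0"
      using v A by (simp add: W(4) mult_mat_vec smult_smult_assoc mult.commute)
    moreover have "A *\<^sub>v col W 0 = col (A * W) 0" using col_mult2[OF A W(1)] by simp
    ultimately have AW: "col (A * W) 0 = e \<cdot>\<^sub>v col W 0" by simp
    \<comment> \<open>The first column of \<open>W\<close> is an eigenvector, so the first column of
      \<open>B\<close> is \<open>e\<close> times that of \<open>mat_adjoint W * W\<close>, the
      identity.\<close>
    have B0: "B $$ (i, 0) = (if i = 0 then e else 0)" if "i < Suc m" for i
    proof -
      have "B = mat_adjoint W * (A * W)" using W(1) A
        by (simp add: B_def mult_mat_assoc del: assoc_mult_mat)
      then have "B $$ (i, 0) = row (mat_adjoint W) i \<bullet> col (A * W) 0" using that W(1) A by simp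
      also have "\<dots> = row (mat_adjoint W) i \<bullet> (e \<cdot>\<^sub>v col W 0)" by (simp only: AW)
      also have "\<dots> = e * (mat_adjoint W * W) $$ (i, 0)" using that W(1) by simp
      finally show ?thesis using that by (simp add: W(2))
    qed
    have Bsym: "B $$ (j, i) = cnj (B $$ (i, j))" if "i < Suc m" "j < Suc m" for i j
      using that B BH by (metis carrier_matD index_adjoint)
    \<comment> \<open>A diagonal entry of the Hermitian matrix \<open>B\<close>, hence real.\<close>
    have e: "e = complex_of_real (Re e)"
      using Bsym[of 0 0] B0[of 0] by (simp add: complex_eq_iff)
    define C where "C = mat m m (\<lambda>(i, j). B $$ (Suc i, Suc j))"
    have C: "C \<in> carrier_mat m m" by (simp add: C_def)
    have "mat_adjoint C = C"
      by (rule eq_matI) (auto simp: C_def Bsym[symmetric])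
    then obtain V d where V: "V \<in> carrier_mat m m" "V * mat_adjoint V = 1\<^sub>m m"
      and CV: "C = V * mat_diag m (\<lambda>i. complex_of_real (d i)) * mat_adjoint V"
      using Suc.IH[OF C] by (auto simp: diagonalizes_def)
    define T where "T = bordered 1 V"
    have T: "T \<in> carrier_mat (Suc m) (Suc m)" using V(1) by (simp add: T_def)
    have Ta: "mat_adjoint T = bordered 1 (mat_adjoint V)" using V(1) by (simp add: T_def bordered_adjoint)
    define f where "f i = (case i of 0 \<Rightarrow> Re e | Suc k \<Rightarrow> d k)" for i
    have D: "mat_diag (Suc m) (\<lambda>i. complex_of_real (f i)) = bordered e (mat_diag m (\<lambda>i. complex_of_real (d i)))"
      using e by (intro eq_matI) (auto simp: mat_diag_def f_def bordered_def split: nat.split)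
    have TT: "T * mat_adjoint T = 1\<^sub>m (Suc m)"
      unfolding Ta by (simp add: T_def bordered_mult[OF V(1) adjoint_carrier[OF V(1)]] V(2) bordered_one)
    have BT: "B = T * mat_diag (Suc m) (\<lambda>i. complex_of_real (f i)) * mat_adjoint T"
    proof -
      have "B = bordered e C"
      proof (rule eq_matI)
        fix i j assume "i < dim_row (bordered e C)" "j < dim_col (bordered e C)"
        then show "B $$ (i, j) = bordered e C $$ (i, j)"
          using B0 Bsym[of j 0] e by (cases i; cases j) (auto simp: C_def bordered_def)
      qed (use B in \<open>auto simp: C_def bordered_def\<close>)
      also have "\<dots> = T * mat_diag (Suc m) (\<lambda>i. complex_of_real (f i)) * mat_adjoint T"
        unfolding Ta D unfolding T_def
        by (simp add: bordered_mult[OF V(1) mat_diag_dim]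
            bordered_mult[OF mult_carrier_mat[OF V(1) mat_diag_dim] adjoint_carrier[OF V(1)]] CV del: assoc_mult_mat)
      finally show ?thesis .
    qed
    let ?D = "mat_diag (Suc m) (\<lambda>i. complex_of_real (f i))"
    have U: "(W * T) * mat_adjoint (W * T) = 1\<^sub>m (Suc m)"
    proof -
      have "(W * T) * mat_adjoint (W * T) = W * mat_adjoint W"
        using W(1) T by (simp add: adjoint_mult[OF W(1) T] mult_mat_assoc mult_mat_cancel[OF TT] del: assoc_mult_mat)
      then show ?thesis by (simp add: W(3))
    qed
    have "A = (W * T) * ?D * mat_adjoint (W * T)"
      unfolding AB BT
      by (simp add: carrier_matD[OF W(1)] carrier_matD[OF T] adjoint_mult[OF W(1) T] mult_mat_assoc del: assoc_mult_mat)
    then have "diagonalizes (Suc m) (W * T) f A"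
      using U W(1) T by (simp add: diagonalizes_def)
    then show ?case by blast
  qed
  then show ?thesis using that by blast
qed

section \<open>Entropy from eigenvalues\<close>

definition xlog2 :: "real \<Rightarrow> real" where "xlog2 x = x * log 2 x"

lemma diagonalizesD:
  assumes "diagonalizes n U d A"
  shows "U \<in> carrier_mat n n" "A \<in> carrier_mat n n" "U * mat_adjoint U = 1\<^sub>m n" "mat_adjoint U * U = 1\<^sub>m n"
    "A = U * mat_diag n (\<lambda>i. complex_of_real (d i)) * mat_adjoint U"
proof -
  show U: "U \<in> carrier_mat n n" "U * mat_adjoint U = 1\<^sub>m n"
    "A = U * mat_diag n (\<lambda>i. complex_of_real (d i)) * mat_adjoint U"
    using assms by (auto simp: diagonalizes_def)
  show "mat_adjoint U * U = 1\<^sub>m n"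
    using mat_mult_left_right_inverse[OF U(1) adjoint_carrier[OF U(1)] U(2)] .
  show "A \<in> carrier_mat n n"
    unfolding U(3) by (rule mult_carrier_mat[OF mult_carrier_mat[OF U(1) mat_diag_dim] adjoint_carrier[OF U(1)]])
qed

lemma index_conj_diag:
  assumes U: "U \<in> carrier_mat n n" and ij: "i < n" "j < n"
  shows "(U * mat_diag n f * mat_adjoint U) $$ (i, j) = (\<Sum>l<n. f l * (U $$ (i, l) * cnj (U $$ (j, l))))"
  using ij carrier_matD[OF U]
  by (simp add: mat_diag_mult_right[OF U] index_mult_sum[where k = n] ac_simps del: index_mult_mat(1))

text \<open>The entrywise form serves to verify explicit diagonalizations by simplification and to
  read matrix entries as spectral sums.\<close>

lemma diagonalizes_iff:
  "diagonalizes n U d A \<longleftrightarrow> U \<in> carrier_mat n n \<and> A \<in> carrier_mat n n \<and>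
     (\<forall>i<n. \<forall>j<n. (\<Sum>l<n. U $$ (i, l) * cnj (U $$ (j, l))) = (if i = j then 1 else 0)) \<and>
     (\<forall>i<n. \<forall>j<n. A $$ (i, j) = (\<Sum>l<n. complex_of_real (d l) * (U $$ (i, l) * cnj (U $$ (j, l)))))"
  (is "?L \<longleftrightarrow> ?U \<and> ?A \<and> ?O \<and> ?E")
proof
  assume L: ?L
  note D = diagonalizesD[OF L]
  have "(\<Sum>l<n. U $$ (i, l) * cnj (U $$ (j, l))) = (if i = j then 1 else 0)" if "i < n" "j < n" for i j
  proof -
    have "(U * mat_adjoint U) $$ (i, j) = (\<Sum>l<n. U $$ (i, l) * cnj (U $$ (j, l)))"
      using that carrier_matD[OF D(1)] by (simp add: index_mult_sum[where k = n] del: index_mult_mat(1))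
    then show ?thesis using that by (simp add: D(3))
  qed
  moreover have ?E by (subst D(5)) (simp add: index_conj_diag[OF D(1)] del: index_mult_mat(1))
  ultimately show "?U \<and> ?A \<and> ?O \<and> ?E" using D(1,2) by blast
next
  assume R: "?U \<and> ?A \<and> ?O \<and> ?E"
  then have U: ?U and A: ?A and O: ?O and E: ?E by blast+
  note [simp] = carrier_matD[OF U] carrier_matD[OF A]
  have "U * mat_adjoint U = 1\<^sub>m n"
    using O by (intro eq_matI) (auto simp: index_mult_sum[where k = n] simp del: index_mult_mat(1))
  moreover have "A = U * mat_diag n (\<lambda>i. complex_of_real (d i)) * mat_adjoint U"
    using E by (intro eq_matI) (auto simp: index_conj_diag[OF U] simp del: index_mult_mat(1))
  ultimately show ?L using U by (simp add: diagonalizes_def)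
qed

text \<open>The functional calculus is well defined: the change of basis \<open>W\<close>
  intertwines the two diagonal matrices, so it connects only equal eigenvalues and intertwines their
  images under \<open>f\<close> as well.\<close>

lemma diagonalizes_intertwine:
  assumes "diagonalizes n U d A" "diagonalizes n V e A"
  shows "U * mat_diag n (\<lambda>i. complex_of_real (f (d i))) * mat_adjoint U
    = V * mat_diag n (\<lambda>i. complex_of_real (f (e i))) * mat_adjoint V"
proof -
  note U = diagonalizesD[OF assms(1)] and V = diagonalizesD[OF assms(2)]
  note [simp] = carrier_matD[OF U(1)] carrier_matD[OF V(1)]
  define W where "W = mat_adjoint V * U"
  have W: "W \<in> carrier_mat n n" unfolding W_def using mult_carrier_mat[OF adjoint_carrier[OF V(1)] U(1)] .
  note assoc = mult_mat_assoc mult_mat_cancel[OF U(3)] mult_mat_cancel[OF U(4)]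
    mult_mat_cancel[OF V(3)] mult_mat_cancel[OF V(4)]
  have "W * mat_diag n (\<lambda>i. complex_of_real (d i)) = mat_adjoint V * A * U"
    by (subst U(5)) (simp add: W_def assoc U(4) right_mult_one_mat[OF mat_diag_dim] del: assoc_mult_mat)
  also have "\<dots> = mat_diag n (\<lambda>i. complex_of_real (e i)) * W"
    by (subst V(5)) (simp add: W_def assoc del: assoc_mult_mat)
  finally have WD: "W $$ (i, j) * complex_of_real (d j) = complex_of_real (e i) * W $$ (i, j)" if "i < n" "j < n" for i j
    using that by (simp add: mat_diag_mult_left[OF W] mat_diag_mult_right[OF W] mat_eq_iff)
  then have "W $$ (i, j) * complex_of_real (f (d j)) = complex_of_real (f (e i)) * W $$ (i, j)" if "i < n" "j < n" for i j
    using WD[OF that] by (cases "W $$ (i, j) = 0") (auto simp: mult.commute)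
  then have Wf: "W * mat_diag n (\<lambda>i. complex_of_real (f (d i))) = mat_diag n (\<lambda>i. complex_of_real (f (e i))) * W"
    using carrier_matD[OF W] by (intro eq_matI) (auto simp: mat_diag_mult_left[OF W] mat_diag_mult_right[OF W])
  have "U * mat_diag n (\<lambda>i. complex_of_real (f (d i))) * mat_adjoint U
      = V * (W * mat_diag n (\<lambda>i. complex_of_real (f (d i)))) * mat_adjoint U"
    by (simp add: W_def assoc del: assoc_mult_mat)
  also have "\<dots> = V * mat_diag n (\<lambda>i. complex_of_real (f (e i))) * mat_adjoint V"
    unfolding Wf by (simp add: W_def assoc U(3) right_mult_one_mat[OF adjoint_carrier[OF V(1)]] del: assoc_mult_mat)
  finally show ?thesis .
qed

lemma hermitian_fun_eq:
  assumes "diagonalizes n U d A"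
  shows "hermitian_fun f A = U * mat_diag n (\<lambda>i. complex_of_real (f (d i))) * mat_adjoint U"
proof -
  have n: "dim_row A = n" using diagonalizesD(2)[OF assms] by simp
  show ?thesis
    unfolding hermitian_fun_def n
    using assms diagonalizes_intertwine[OF assms]
    by (intro the_equality) (auto simp: diagonalizes_def)
qed

lemma mat_trace_mult_comm:
  assumes "A \<in> carrier_mat m n" "B \<in> carrier_mat n m"
  shows "mat_trace (A * B) = mat_trace (B * A)"
proof -
  note [simp] = carrier_matD[OF assms(1)] carrier_matD[OF assms(2)]
  have "mat_trace (A * B) = (\<Sum>i<m. \<Sum>l<n. A $$ (i, l) * B $$ (l, i))"
    by (simp add: mat_trace_def index_mult_sum[where k = n] del: index_mult_mat(1))
  also have "\<dots> = (\<Sum>l<n. \<Sum>i<m. B $$ (l, i) * A $$ (i, l))"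
    by (subst sum.swap) (simp add: mult.commute)
  also have "\<dots> = mat_trace (B * A)"
    by (simp add: mat_trace_def index_mult_sum[where k = m] del: index_mult_mat(1))
  finally show ?thesis .
qed

text \<open>In the eigenbasis the product of \<open>A\<close> and its logarithm is diagonal, and
  cyclicity of the trace removes the unitaries.\<close>

lemma entropy_diagonalizes:
  assumes "diagonalizes n U d A"
  shows "von_neumann_entropy A = - (\<Sum>i<n. xlog2 (d i))"
proof -
  note U = diagonalizesD[OF assms]
  note [simp] = carrier_matD[OF U(1)]
  let ?D = "\<lambda>g. mat_diag n (\<lambda>i. complex_of_real (g (d i)))"
  have "A * hermitian_fun (log 2) A = (U * ?D (\<lambda>x. x)) * (mat_adjoint U * (U * (?D (log 2) * mat_adjoint U)))"
    unfolding hermitian_fun_eq[OF assms]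
    by (subst (1) U(5)) (simp add: mult_mat_assoc del: assoc_mult_mat)
  also have "\<dots> = U * (?D (\<lambda>x. x) * ?D (log 2) * mat_adjoint U)"
    by (simp add: mult_mat_cancel[OF U(4)] mult_mat_assoc del: assoc_mult_mat mat_diag_diag)
  also have "mat_trace \<dots> = mat_trace (?D (\<lambda>x. x) * ?D (log 2) * mat_adjoint U * U)"
    by (rule mat_trace_mult_comm[OF U(1)])
      (rule mult_carrier_mat[OF mult_carrier_mat[OF mat_diag_dim mat_diag_dim] adjoint_carrier[OF U(1)]])
  also have "\<dots> = mat_trace (?D xlog2)"
    by (simp add: mult_mat_assoc U(4) xlog2_def right_mult_one_mat[OF mat_diag_dim] del: assoc_mult_mat)
  also have "\<dots> = complex_of_real (\<Sum>i<n. xlog2 (d i))"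
    by (simp add: mat_trace_def mat_diag_def)
  finally show ?thesis by (simp add: von_neumann_entropy_def)
qed

lemma entropy_mat_diag:
  "von_neumann_entropy (mat_diag n (\<lambda>i. complex_of_real (d i))) = - (\<Sum>i<n. xlog2 (d i))"
proof (rule entropy_diagonalizes)
  show "diagonalizes n (1\<^sub>m n) d (mat_diag n (\<lambda>i. complex_of_real (d i)))"
    unfolding diagonalizes_def by (simp add: left_mult_one_mat[OF mat_diag_dim] right_mult_one_mat[OF mat_diag_dim])
qed

text \<open>The conjugate of \<open>U\<close> diagonalizes the transpose with the same
  eigenvalues.\<close>

lemma entropy_transpose:
  assumes "diagonalizes n U d A"
  shows "von_neumann_entropy (transpose_mat A) = von_neumann_entropy A"
proof -
  have "(\<Sum>l<n. cnj (U $$ (i, l)) * U $$ (j, l)) = (if i = j then 1 else 0)" if "i < n" "j < n" for i j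
    using that assms unfolding diagonalizes_iff by (subst mult.commute) auto
  then have "diagonalizes n (mat n n (\<lambda>(i, j). cnj (U $$ (i, j)))) d (transpose_mat A)"
    using assms unfolding diagonalizes_iff by (auto simp: mult.commute)
  then show ?thesis using entropy_diagonalizes assms by metis
qed

text \<open>The unitary changes of basis turn \<open>M\<close> into a matrix \<open>W\<close> with \<open>W W\<^sup>\<dagger>\<close> and \<open>W\<^sup>\<dagger> W\<close> diagonal;
  then \<open>d\<^sub>i = e\<^sub>j\<close> wherever \<open>W\<^sub>i\<^sub>j \<noteq> 0\<close>, and both entropies are
  \<open>- \<Sum>\<^sub>i\<^sub>j |W\<^sub>i\<^sub>j|\<^sup>2 log d\<^sub>i\<close>.\<close>

lemma entropy_mult_adjoint:
  assumes M: "M \<in> carrier_mat m n"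
  shows "von_neumann_entropy (M * mat_adjoint M) = von_neumann_entropy (mat_adjoint M * M)"
proof -
  note Ma = adjoint_carrier[OF M]
  obtain U d where dU: "diagonalizes m U d (M * mat_adjoint M)"
    using spectral_theorem[OF mult_carrier_mat[OF M Ma]] adjoint_mult[OF M Ma] by auto
  obtain V e where dV: "diagonalizes n V e (mat_adjoint M * M)"
    using spectral_theorem[OF mult_carrier_mat[OF Ma M]] adjoint_mult[OF Ma M] by auto
  note U = diagonalizesD[OF dU] and V = diagonalizesD[OF dV]
  note [simp] = carrier_matD[OF U(1)] carrier_matD[OF V(1)] carrier_matD[OF M]
  define W where "W = mat_adjoint U * (M * V)"
  have W: "W \<in> carrier_mat m n"
    unfolding W_def by (rule mult_carrier_mat[OF adjoint_carrier[OF U(1)] mult_carrier_mat[OF M V(1)]])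
  have Wa: "mat_adjoint W = mat_adjoint V * (mat_adjoint M * U)"
    unfolding W_def adjoint_mult[OF adjoint_carrier[OF U(1)] mult_carrier_mat[OF M V(1)]] adjoint_mult[OF M V(1)]
    by (simp add: mult_mat_assoc del: assoc_mult_mat)
  note assoc = mult_mat_assoc mult_mat_cancel[OF U(3)] mult_mat_cancel[OF U(4)]
    mult_mat_cancel[OF V(3)] mult_mat_cancel[OF V(4)]
  have "W * mat_adjoint W = mat_adjoint U * (M * mat_adjoint M) * U"
    unfolding Wa unfolding W_def by (simp add: assoc del: assoc_mult_mat)
  also have "\<dots> = mat_diag m (\<lambda>i. complex_of_real (d i))"
    unfolding U(5) by (simp add: assoc U(4) right_mult_one_mat[OF mat_diag_dim] del: assoc_mult_mat)
  finally have WW: "W * mat_adjoint W = mat_diag m (\<lambda>i. complex_of_real (d i))" .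
  have "mat_adjoint W * W = mat_adjoint V * (mat_adjoint M * M) * V"
    unfolding Wa unfolding W_def by (simp add: assoc del: assoc_mult_mat)
  also have "\<dots> = mat_diag n (\<lambda>i. complex_of_real (e i))"
    unfolding V(5) by (simp add: assoc V(4) right_mult_one_mat[OF mat_diag_dim] del: assoc_mult_mat)
  finally have WW': "mat_adjoint W * W = mat_diag n (\<lambda>i. complex_of_real (e i))" .
  note [simp] = carrier_matD[OF W]
  have d: "d i = (\<Sum>j<n. (cmod (W $$ (i, j)))\<^sup>2)" if "i < m" for i
  proof -
    have "complex_of_real (d i) = (W * mat_adjoint W) $$ (i, i)"
      using that by (simp add: WW mat_diag_def)
    also have "\<dots> = complex_of_real (\<Sum>j<n. (cmod (W $$ (i, j)))\<^sup>2)"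
      using that by (simp add: index_mult_sum[where k = n] complex_norm_square del: index_mult_mat(1) of_real_power)
    finally show ?thesis by (simp only: of_real_eq_iff)
  qed
  have e: "e j = (\<Sum>i<m. (cmod (W $$ (i, j)))\<^sup>2)" if "j < n" for j
  proof -
    have "complex_of_real (e j) = (mat_adjoint W * W) $$ (j, j)"
      using that by (simp add: WW' mat_diag_def)
    also have "\<dots> = complex_of_real (\<Sum>i<m. (cmod (W $$ (i, j)))\<^sup>2)"
      using that by (simp add: index_mult_sum[where k = m] complex_norm_square mult.commute del: index_mult_mat(1) of_real_power)
    finally show ?thesis by (simp only: of_real_eq_iff)
  qed
  \<comment> \<open>Both sides are \<open>W * mat_adjoint W * W\<close>.\<close>
  have "mat_diag m (\<lambda>i. complex_of_real (d i)) * W = W * mat_diag n (\<lambda>i. complex_of_real (e i))"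
    unfolding WW[symmetric] WW'[symmetric] by (simp add: mult_mat_assoc del: assoc_mult_mat)
  then have dWe: "complex_of_real (d i) * W $$ (i, j) = W $$ (i, j) * complex_of_real (e j)" if "i < m" "j < n" for i j
    using that by (simp add: mat_diag_mult_left[OF W] mat_diag_mult_right[OF W] mat_eq_iff)
  then have de: "(cmod (W $$ (i, j)))\<^sup>2 * log 2 (d i) = (cmod (W $$ (i, j)))\<^sup>2 * log 2 (e j)" if "i < m" "j < n" for i j
    using dWe[OF that] by (cases "W $$ (i, j) = 0") (auto simp: mult.commute)
  have "(\<Sum>i<m. xlog2 (d i)) = (\<Sum>i<m. \<Sum>j<n. (cmod (W $$ (i, j)))\<^sup>2 * log 2 (d i))"
    by (intro sum.cong) (auto simp: xlog2_def d sum_distrib_right)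
  also have "\<dots> = (\<Sum>j<n. \<Sum>i<m. (cmod (W $$ (i, j)))\<^sup>2 * log 2 (e j))"
    by (subst sum.swap) (simp add: de)
  also have "\<dots> = (\<Sum>j<n. xlog2 (e j))"
    by (intro sum.cong) (auto simp: xlog2_def e sum_distrib_right)
  finally show ?thesis using entropy_diagonalizes[OF dU] entropy_diagonalizes[OF dV] by simp
qed

section \<open>Randomness and coherence\<close>

lemma mult_add_less: "i * n + k < m * n" if "i < m" "k < n" for i k m n :: nat
proof -
  have "Suc i * n \<le> m * n" using that by (intro mult_le_mono1) simp
  then show ?thesis using that by simp
qed

lemma div_mod_less:
  fixes r m n :: nat
  assumes "r < m * n"
  shows "r div n < m" "r mod n < n" "r div n * n + r mod n = r"
  using assms by (auto simp: less_mult_imp_div_less) (metis mod_less_divisor mult_0_right neq0_conv not_less0)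

lemma index_measured_state:
  assumes "r < m * n" "c < m * n" "\<psi> \<in> carrier_vec (m * n)"
  shows "measured_state m n \<psi> $$ (r, c) = (if r div n = c div n then \<psi> $ r * cnj (\<psi> $ c) else 0)"
proof -
  note r = div_mod_less[OF assms(1)] and c = div_mod_less[OF assms(2)]
  have "measured_state m n \<psi> $$ (r, c) = (\<Sum>i<m. if i = r div n then
      (if r div n = c div n then \<psi> $ r * cnj (\<psi> $ c) else 0) else 0)"
    unfolding measured_state_def index_mat(1)[OF assms(1,2)] prod.case
  proof (rule sum.cong)
    fix i assume "i \<in> {..<m}"
    then show "tensor_mat (ketbra (unit_vec m i) (unit_vec m i))
         (ketbra (bra_fst n i \<psi>) (bra_fst n i \<psi>)) $$ (r, c) = (if i = r div n then
      (if r div n = c div n then \<psi> $ r * cnj (\<psi> $ c) else 0) else 0)"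
      using assms r c by (simp add: tensor_mat_def ketbra_def bra_fst_def unit_vec_def)
  qed simp
  then show ?thesis using r by simp
qed

text \<open>The right-hand side mentions neither \<open>n\<close> nor \<open>\<psi>\<close>, so all
  purifications give the same value, as the description in \<open>randomness\<close>
  requires.\<close>

lemma conditional_entropy_measured_state:
  assumes \<rho>: "diagonalizes m U d \<rho>" and \<psi>: "purifies n \<psi> \<rho>"
  shows "conditional_entropy m n (measured_state m n \<psi>) = coherence \<rho>"
proof -
  have R: "\<rho> \<in> carrier_mat m m" using diagonalizesD(2)[OF \<rho>] .
  note [simp] = carrier_matD[OF R]
  have P: "\<psi> \<in> carrier_vec (m * n)" and pt: "partial_trace_snd m n (ketbra \<psi> \<psi>) = \<rho>"
    using \<psi> by (auto simp: purifies_def)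
  note [simp] = carrier_vecD[OF P]
  have ent: "\<rho> $$ (i, j) = (\<Sum>k<n. \<psi> $ (i * n + k) * cnj (\<psi> $ (j * n + k)))" if "i < m" "j < m" for i j
    using that unfolding pt[symmetric] by (simp add: partial_trace_snd_def ketbra_def mult_add_less)
  \<comment> \<open>\<open>N\<close> is the amplitude matrix of \<open>\<psi>\<close> with rows for
    \<open>E\<close>; column \<open>i\<close> of \<open>W\<close> is the basis vector
    \<open>i\<close> of \<open>Q\<close> tensored with \<open>bra_fst n i \<psi>\<close>.\<close>
  define N where "N = mat n m (\<lambda>(k, i). \<psi> $ (i * n + k))"
  define W where "W = mat (m * n) m (\<lambda>(r, i). if r div n = i then \<psi> $ r else 0)"
  have N: "N \<in> carrier_mat n m" and W: "W \<in> carrier_mat (m * n) m" by (auto simp: N_def W_def)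
  note [simp] = carrier_matD[OF N] carrier_matD[OF W]
  have "measured_state m n \<psi> = W * mat_adjoint W"
  proof (rule eq_matI)
    fix r c assume "r < dim_row (W * mat_adjoint W)" "c < dim_col (W * mat_adjoint W)"
    then have rc: "r < m * n" "c < m * n" by auto
    have "(W * mat_adjoint W) $$ (r, c) = (\<Sum>i<m. if i = r div n then (if r div n = c div n then \<psi> $ r * cnj (\<psi> $ c) else 0) else 0)"
      using rc by (simp add: index_mult_sum[where k = m] W_def if_distrib cong: if_cong del: index_mult_mat(1))
        (rule sum.cong, auto)
    then show "measured_state m n \<psi> $$ (r, c) = (W * mat_adjoint W) $$ (r, c)"
      using rc div_mod_less(1)[OF rc(1)] by (simp add: index_measured_state[OF rc P] del: index_mult_mat(1))
  qed (auto simp: measured_state_def)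
  moreover have "mat_adjoint W * W = diagonal_part \<rho>"
  proof (rule eq_matI)
    fix i j assume "i < dim_row (diagonal_part \<rho>)" "j < dim_col (diagonal_part \<rho>)"
    then have ij: "i < m" "j < m" by (auto simp: diagonal_part_def)
    have "(mat_adjoint W * W) $$ (i, j) = (\<Sum>r<m * n. cnj (W $$ (r, i)) * W $$ (r, j))"
      using ij by (simp add: index_mult_sum[where k = "m * n"] del: index_mult_mat(1))
    also have "\<dots> = (\<Sum>l<m. \<Sum>r\<in>{l * n..<l * n + n}. cnj (W $$ (r, i)) * W $$ (r, j))"
      by (rule sum.nat_group[symmetric])
    also have "\<dots> = (\<Sum>l<m. \<Sum>k<n. cnj (W $$ (l * n + k, i)) * W $$ (l * n + k, j))"
    proof (rule sum.cong[OF refl])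
      fix l
      show "(\<Sum>r\<in>{l * n..<l * n + n}. cnj (W $$ (r, i)) * W $$ (r, j))
          = (\<Sum>k<n. cnj (W $$ (l * n + k, i)) * W $$ (l * n + k, j))"
        by (rule sum.reindex_bij_witness[of _ "\<lambda>k. l * n + k" "\<lambda>r. r - l * n"]) auto
    qed
    also have "\<dots> = (\<Sum>l<m. if l = i then (if i = j then \<rho> $$ (i, i) else 0) else 0)"
      using ij by (intro sum.cong refl) (auto simp: W_def mult_add_less ent mult.commute)
    also have "\<dots> = diagonal_part \<rho> $$ (i, j)"
      using ij by (simp add: diagonal_part_def mat_diag_def)
    finally show "(mat_adjoint W * W) $$ (i, j) = diagonal_part \<rho> $$ (i, j)" .
  qed (auto simp: diagonal_part_def)
  ultimately have Q: "von_neumann_entropy (measured_state m n \<psi>) = von_neumann_entropy (diagonal_part \<rho>)"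
    using entropy_mult_adjoint[OF W] by simp
  \<comment> \<open>Measuring \<open>Q\<close> leaves the state of \<open>E\<close> unchanged,
    because the partial trace over \<open>Q\<close> sees only diagonal blocks.\<close>
  have "partial_trace_fst m n (measured_state m n \<psi>) = N * mat_adjoint N"
    by (rule eq_matI) (auto simp: partial_trace_fst_def index_measured_state[OF _ _ P] mult_add_less N_def
        index_mult_sum[where k = m] simp del: index_mult_mat(1))
  moreover have "mat_adjoint N * N = transpose_mat \<rho>"
    by (rule eq_matI) (auto simp: ent N_def index_mult_sum[where k = n] mult.commute simp del: index_mult_mat(1))
  ultimately have "von_neumann_entropy (partial_trace_fst m n (measured_state m n \<psi>)) = von_neumann_entropy \<rho>"
    using entropy_mult_adjoint[OF N] entropy_transpose[OF \<rho>] by simp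
  then show ?thesis using Q by (simp add: conditional_entropy_def coherence_def)
qed

text \<open>The standard purification: the sum of \<open>sqrt (d k)\<close> times the
  \<open>k\<close>-th eigenvector, tensored with the basis vector \<open>k\<close> of a copy of the
  space.\<close>

lemma purification_exists:
  assumes \<rho>: "diagonalizes m U d \<rho>" and d: "\<And>i. i < m \<Longrightarrow> 0 \<le> d i"
  shows "\<exists>\<psi>. purifies m \<psi> \<rho>"
proof
  have R: "\<rho> \<in> carrier_mat m m" using diagonalizesD(2)[OF \<rho>] .
  note [simp] = carrier_matD[OF R]
  let ?\<psi> = "vec (m * m) (\<lambda>x. U $$ (x div m, x mod m) * complex_of_real (sqrt (d (x mod m))))"
  have sq: "complex_of_real (sqrt (d k)) * complex_of_real (sqrt (d k)) = complex_of_real (d k)" if "k < m" for k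
    using d[OF that] by (simp flip: of_real_mult)
  have "partial_trace_snd m m (ketbra ?\<psi> ?\<psi>) = \<rho>"
  proof (rule eq_matI)
    fix i j assume "i < dim_row \<rho>" "j < dim_col \<rho>"
    then have ij: "i < m" "j < m" by auto
    have "partial_trace_snd m m (ketbra ?\<psi> ?\<psi>) $$ (i, j)
      = (\<Sum>k<m. (complex_of_real (sqrt (d k)) * complex_of_real (sqrt (d k))) * (U $$ (i, k) * cnj (U $$ (j, k))))"
      using ij by (simp add: partial_trace_snd_def ketbra_def mult_add_less, simp add: ac_simps)
    also have "\<dots> = (\<Sum>k<m. complex_of_real (d k) * (U $$ (i, k) * cnj (U $$ (j, k))))"
      by (intro sum.cong refl) (simp only: sq lessThan_iff)
    also have "\<dots> = \<rho> $$ (i, j)"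
      using ij \<rho> by (simp add: diagonalizes_iff)
    finally show "partial_trace_snd m m (ketbra ?\<psi> ?\<psi>) $$ (i, j) = \<rho> $$ (i, j)" .
  qed (auto simp: partial_trace_snd_def)
  then show "purifies m ?\<psi> \<rho>" by (simp add: purifies_def)
qed

text \<open>A purification exists and all of them give the coherence, so the definite description
  denotes it.\<close>

lemma randomness_eq_coherence:
  assumes "diagonalizes m U d \<rho>" "\<And>i. i < m \<Longrightarrow> 0 \<le> d i"
  shows "randomness \<rho> = coherence \<rho>"
proof -
  have m: "dim_row \<rho> = m" using diagonalizesD(2)[OF assms(1)] by simp
  obtain \<psi> where \<psi>: "purifies m \<psi> \<rho>" using purification_exists[OF assms] by blast
  show ?thesis
    unfolding randomness_def m
  proof (rule the_equality)
    show "\<exists>n \<psi>. purifies n \<psi> \<rho> \<and> coherence \<rho> = conditional_entropy m n (measured_state m n \<psi>)"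
      using \<psi> conditional_entropy_measured_state[OF assms(1) \<psi>] by metis
  qed (use conditional_entropy_measured_state[OF assms(1)] in auto)
qed

section \<open>Inequalities for the binary entropy\<close>

text \<open>For \<open>\<bar>s\<bar> \<le> 1\<close> this is
  \<open>2 * ln 2 * (1 - binary_entropy ((1 + s) / 2))\<close>, in natural logarithms to ease
  differentiation.\<close>

definition phi :: "real \<Rightarrow> real" where
  "phi s = (1 + s) * ln (1 + s) + (1 - s) * ln (1 - s)"

lemma x_ln_x_ge: "0 \<le> x \<Longrightarrow> x - 1 \<le> x * ln (x::real)"
proof (cases "x = 0")
  case False
  assume "0 \<le> x"
  then have "ln (1 / x) \<le> 1 / x - 1" using False by (intro ln_le_minus_one) auto
  then have "x * (- ln x) \<le> x * (1 / x - 1)"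
    using \<open>0 \<le> x\<close> False by (intro mult_left_mono) (auto simp: ln_div)
  then show ?thesis using False by (simp add: algebra_simps)
qed simp

lemma phi_minus [simp]: "phi (- s) = phi s"
  by (simp add: phi_def)

lemma phi_nonneg: "\<bar>s\<bar> \<le> 1 \<Longrightarrow> 0 \<le> phi s"
  using x_ln_x_ge[of "1 + s"] x_ln_x_ge[of "1 - s"] by (auto simp: phi_def abs_le_iff)

text \<open>For \<open>0 < s\<close> this is the derivative of \<open>phi s / s\<^sup>2\<close> up
  to a positive factor. It vanishes at 0, and so does its derivative \<open>?chi\<close>, whose own
  derivative \<open>x / (1 - x)\<^sup>2 - x / (1 + x)\<^sup>2\<close> is nonnegative.\<close>

lemma phi_ratio_deriv_nonneg:
  assumes "0 \<le> s" "s < (1::real)"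
  shows "0 \<le> - (2 + s) * ln (1 + s) - (2 - s) * ln (1 - s)"
proof -
  let ?chi = "\<lambda>s::real. - ln (1 + s) - (2 + s) / (1 + s) + ln (1 - s) + (2 - s) / (1 - s)"
  have chi: "0 \<le> ?chi t" if "0 \<le> t" "t < 1" for t
  proof -
    have "?chi 0 \<le> ?chi t"
    proof (rule DERIV_nonneg_imp_nondecreasing[OF that(1)])
      fix x :: real assume x: "0 \<le> x" "x \<le> t"
      have "(?chi has_real_derivative (- (1 / (1 + x)) - (1 * (1 + x) - (2 + x) * 1) / ((1 + x) * (1 + x))
          + - 1 / (1 - x) + (- 1 * (1 - x) - (2 - x) * - 1) / ((1 - x) * (1 - x)))) (at x)"
        using x that by (auto intro!: derivative_eq_intros)
      moreover have "- (1 / (1 + x)) - (1 * (1 + x) - (2 + x) * 1) / ((1 + x) * (1 + x)) = - (x / (1 + x)\<^sup>2)"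
        using x by (simp add: divide_simps power2_eq_square)
      moreover have "- 1 / (1 - x) + (- 1 * (1 - x) - (2 - x) * - 1) / ((1 - x) * (1 - x)) = x / (1 - x)\<^sup>2"
        using x that by (simp add: divide_simps power2_eq_square)
      ultimately have "(?chi has_real_derivative x / (1 - x)\<^sup>2 - x / (1 + x)\<^sup>2) (at x)"
        by (simp only: add.assoc) simp
      moreover have "x / (1 + x)\<^sup>2 \<le> x / (1 - x)\<^sup>2"
        using x that by (intro divide_left_mono power_mono mult_pos_pos zero_less_power) auto
      ultimately show "\<exists>y. (?chi has_real_derivative y) (at x) \<and> 0 \<le> y" by force
    qed
    then show ?thesis by simp
  qed
  let ?psi = "\<lambda>s::real. - (2 + s) * ln (1 + s) - (2 - s) * ln (1 - s)"
  have "?psi 0 \<le> ?psi s"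
  proof (rule DERIV_nonneg_imp_nondecreasing[OF assms(1)])
    fix x :: real assume x: "0 \<le> x" "x \<le> s"
    have "(?psi has_real_derivative ?chi x) (at x)"
      using x assms by (auto intro!: derivative_eq_intros simp: divide_simps)
        (simp add: algebra_simps)
    then show "\<exists>y. (?psi has_real_derivative y) (at x) \<and> 0 \<le> y" using chi[of x] x assms by force
  qed
  then show ?thesis by simp
qed

text \<open>The derivative of \<open>phi s / s\<^sup>2\<close> is nonnegative; the denominators are
  cleared. The bound \<open>r < 1\<close> keeps \<open>ln (1 - x)\<close> differentiable on the
  interval.\<close>

lemma phi_ratio_mono_less:
  assumes "0 < s" "s \<le> r" "r < 1"
  shows "phi s * r\<^sup>2 \<le> phi r * s\<^sup>2"
proof -
  let ?h = "\<lambda>s. phi s / s\<^sup>2"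
  have "?h s \<le> ?h r"
  proof (rule DERIV_nonneg_imp_nondecreasing[OF assms(2)])
    fix x assume x: "s \<le> x" "x \<le> r"
    then have x': "0 < x" "x < 1" using assms by auto
    let ?p = "- (2 + x) * ln (1 + x) - (2 - x) * ln (1 - x)"
    have "(phi has_real_derivative ln (1 + x) - ln (1 - x)) (at x)"
      unfolding phi_def[abs_def] using x' by (auto intro!: derivative_eq_intros)
    then have "(?h has_real_derivative ((ln (1 + x) - ln (1 - x)) * x\<^sup>2 - phi x * (2 * x)) / (x\<^sup>2 * x\<^sup>2)) (at x)"
      using x' by (auto intro!: derivative_eq_intros)
    moreover have "(ln (1 + x) - ln (1 - x)) * x\<^sup>2 - phi x * (2 * x) = x * ?p"
      by (simp add: phi_def algebra_simps power2_eq_square)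
    ultimately show "\<exists>y. (?h has_real_derivative y) (at x) \<and> 0 \<le> y"
      using phi_ratio_deriv_nonneg[of x] x' by (intro exI[of _ "x * ?p / (x\<^sup>2 * x\<^sup>2)"]) auto
  qed
  then show ?thesis using assms by (simp add: divide_simps mult.commute split: if_splits)
qed

lemma phi_le:
  assumes "0 \<le> r" "r \<le> 1"
  shows "phi r \<le> 2 * ln 2"
proof -
  have "(1 + r) * ln (1 + r) \<le> 2 * ln 2" using assms by (intro mult_mono) auto
  moreover have "(1 - r) * ln (1 - r) \<le> 0"
    using assms by (cases "r = 1") (auto intro!: mult_nonneg_nonpos)
  ultimately show ?thesis by (simp add: phi_def)
qed

text \<open>At \<open>r = 1\<close> the bound \<open>phi \<le> 2 ln 2 = phi 1\<close> replaces continuity of \<open>x ln x\<close> at \<open>0\<close>.\<close>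

lemma phi_ratio_mono:
  assumes "0 \<le> s" "s \<le> r" "r \<le> 1"
  shows "phi s * r\<^sup>2 \<le> phi r * s\<^sup>2"
proof -
  consider "s = 0" | "s = 1" | "0 < s" "s < 1" "r < 1" | "0 < s" "s < 1" "r = 1" using assms by linarith
  then show ?thesis
  proof cases
    case 4
    have "phi s \<le> phi 1 * s\<^sup>2"
    proof (rule field_le_mult_one_interval)
      fix z :: real assume z: "0 < z" "z < 1"
      \<comment> \<open>Any \<open>q\<close> with \<open>s \<le> q\<close>, \<open>q < 1\<close> and
        \<open>z \<le> q\<^sup>2\<close> reduces the claim to the open range; the factor
        \<open>z\<close> stands in for the limit of \<open>q\<close> to 1.\<close>
      define q where "q = max s (sqrt z)"
      have q: "s \<le> q" "q < 1" "z \<le> q\<^sup>2"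
        using z 4 real_sqrt_le_iff[of z "q\<^sup>2"] by (auto simp: q_def max_def)
      have "z * phi s \<le> phi s * q\<^sup>2"
        using q phi_nonneg[of s] 4 by (subst mult.commute) (intro mult_left_mono, auto)
      also have "\<dots> \<le> phi q * s\<^sup>2" using phi_ratio_mono_less[of s q] q 4 by simp
      also have "\<dots> \<le> phi 1 * s\<^sup>2"
        using phi_le[of q] q 4 by (intro mult_right_mono) (auto simp: phi_def)
      finally show "z * phi s \<le> phi 1 * s\<^sup>2" .
    qed
    then show ?thesis using 4 by simp
  qed (use assms phi_ratio_mono_less[of s r] in \<open>auto simp: phi_def\<close>)
qed

text \<open>For \<open>\<bar>x\<bar> \<le> r\<close> the ratio bound gives
  \<open>phi x \<le> phi r * x\<^sup>2 / r\<^sup>2\<close>; it remains to add the cases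
  \<open>z\<close> and \<open>t\<close>.\<close>

lemma phi_superadditive:
  assumes "z\<^sup>2 + t\<^sup>2 \<le> r\<^sup>2" "0 \<le> r" "r \<le> 1"
  shows "phi z + phi t \<le> phi r"
proof (cases "r = 0")
  case True
  then have "z\<^sup>2 + t\<^sup>2 \<le> 0" using assms(1) by simp
  then have "z = 0" "t = 0" by (auto simp: sum_power2_le_zero_iff)
  then show ?thesis using True by (simp add: phi_def)
next
  case False
  have abs: "phi x * r\<^sup>2 \<le> phi r * x\<^sup>2" if "x\<^sup>2 \<le> r\<^sup>2" for x
  proof -
    have "\<bar>x\<bar> \<le> r" using that assms(2) by (simp add: abs_le_square_iff[symmetric])
    then have "phi \<bar>x\<bar> * r\<^sup>2 \<le> phi r * \<bar>x\<bar>\<^sup>2" using assms(3) by (intro phi_ratio_mono) auto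
    then show ?thesis by (simp add: abs_if split: if_splits)
  qed
  have "z\<^sup>2 \<le> r\<^sup>2" "t\<^sup>2 \<le> r\<^sup>2" using assms(1) zero_le_power2[of z] zero_le_power2[of t] by linarith+
  then have "(phi z + phi t) * r\<^sup>2 \<le> phi r * (z\<^sup>2 + t\<^sup>2)"
    using abs[of z] abs[of t] by (simp add: algebra_simps)
  also have "\<dots> \<le> phi r * r\<^sup>2"
    using assms phi_nonneg[of r] by (intro mult_left_mono) auto
  finally show ?thesis using False by simp
qed

section \<open>Spectra with two eigenvalues and arbitrary trace\<close>

lemma xlog2_0 [simp]: "xlog2 0 = 0" by (simp add: xlog2_def)

lemma xlog2_mult: "0 < k \<Longrightarrow> 0 \<le> x \<Longrightarrow> xlog2 (k * x) = k * xlog2 x + x * xlog2 k"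
  by (cases "x = 0") (auto simp: xlog2_def log_mult algebra_simps)

text \<open>Minus the entropy of the spectrum of a Hermitian 2 by 2 matrix with trace
  \<open>w\<close> and eigenvalue difference \<open>\<delta>\<close>. The trace is a parameter since
  the blocks of a state carry its weights.\<close>

definition pair_xlog2 :: "real \<Rightarrow> real \<Rightarrow> real" where
  "pair_xlog2 w \<delta> = xlog2 ((w + \<delta>) / 2) + xlog2 ((w - \<delta>) / 2)"

lemma pair_xlog2_minus [simp]: "pair_xlog2 w (- \<delta>) = pair_xlog2 w \<delta>"
  by (simp add: pair_xlog2_def)

lemma pair_xlog2_abs [simp]: "pair_xlog2 w \<bar>\<delta>\<bar> = pair_xlog2 w \<delta>"
  by (simp add: abs_if)

text \<open>The correction \<open>w * xlog2 k\<close> does not depend on \<open>\<delta>\<close>, so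
  differences at equal \<open>w\<close> are homogeneous of degree 1.\<close>

lemma pair_xlog2_scale:
  assumes "0 < k" "\<bar>\<delta>\<bar> \<le> w"
  shows "pair_xlog2 (k * w) (k * \<delta>) = k * pair_xlog2 w \<delta> + w * xlog2 k"
proof -
  have "xlog2 (k * ((w + \<delta>) / 2)) = k * xlog2 ((w + \<delta>) / 2) + (w + \<delta>) / 2 * xlog2 k"
    "xlog2 (k * ((w - \<delta>) / 2)) = k * xlog2 ((w - \<delta>) / 2) + (w - \<delta>) / 2 * xlog2 k"
    using assms by (intro xlog2_mult; simp)+
  then show ?thesis by (simp add: pair_xlog2_def algebra_simps add_divide_distrib diff_divide_distrib)
qed

text \<open>Scaling by \<open>w / 2\<close> reduces this to trace 2, where the eigenvalues are
  \<open>1 + x\<close> and \<open>1 - x\<close>.\<close>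

lemma pair_xlog2_phi:
  assumes "0 < w" "\<bar>\<delta>\<bar> \<le> w"
  shows "pair_xlog2 w \<delta> - pair_xlog2 w 0 = w * phi (\<delta> / w) / (2 * ln 2)"
proof -
  have two: "pair_xlog2 2 (2 * x) = phi x / ln 2" for x
  proof -
    have e: "(2 + 2 * x) / 2 = 1 + x" "(2 - 2 * x) / 2 = 1 - x" by simp_all
    show ?thesis unfolding pair_xlog2_def e by (simp add: phi_def xlog2_def log_def add_divide_distrib)
  qed
  have "pair_xlog2 (w / 2 * 2) (w / 2 * (2 * (\<delta> / w))) = w / 2 * pair_xlog2 2 (2 * (\<delta> / w)) + 2 * xlog2 (w / 2)"
    using assms by (intro pair_xlog2_scale) (auto simp: abs_mult divide_simps)
  then have "pair_xlog2 w \<delta> = w / 2 * (phi (\<delta> / w) / ln 2) + 2 * xlog2 (w / 2)"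
    using assms unfolding two by simp
  moreover have "pair_xlog2 w 0 = 2 * xlog2 (w / 2)" by (simp add: pair_xlog2_def)
  ultimately show ?thesis by simp
qed

text \<open>Dividing by \<open>w\<close> turns this into \<open>phi_superadditive\<close>;
  \<open>pair_xlog2 w 0\<close> is the reference value from \<open>pair_xlog2_phi\<close>.\<close>

lemma pair_xlog2_superadditive:
  assumes "0 \<le> w" "0 \<le> r" "r \<le> w" "\<delta>\<^sup>2 + \<tau>\<^sup>2 \<le> r\<^sup>2"
  shows "pair_xlog2 w \<delta> + pair_xlog2 w \<tau> \<le> pair_xlog2 w r + pair_xlog2 w 0"
proof (cases "w = 0")
  case True
  then have "r = 0" using assms by simp
  then have "\<delta>\<^sup>2 + \<tau>\<^sup>2 \<le> 0" using assms(4) by simp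
  then have "\<delta> = 0" "\<tau> = 0" by (auto simp: sum_power2_le_zero_iff)
  then show ?thesis using \<open>r = 0\<close> by simp
next
  case False
  then have w: "0 < w" using assms(1) by simp
  have "\<delta>\<^sup>2 \<le> r\<^sup>2" "\<tau>\<^sup>2 \<le> r\<^sup>2" using assms(4) zero_le_power2[of \<delta>] zero_le_power2[of \<tau>] by linarith+
  then have le: "\<bar>\<delta>\<bar> \<le> w" "\<bar>\<tau>\<bar> \<le> w"
    using assms by (auto simp: abs_le_square_iff[symmetric])
  have "phi (\<delta> / w) + phi (\<tau> / w) \<le> phi (r / w)"
    using w assms by (intro phi_superadditive) (auto simp: power_divide divide_simps)
  then have "w * (phi (\<delta> / w) + phi (\<tau> / w)) / (2 * ln 2) \<le> w * phi (r / w) / (2 * ln 2)"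
    using w by (intro divide_right_mono mult_left_mono) auto
  then show ?thesis
    using pair_xlog2_phi[OF w le(1)] pair_xlog2_phi[OF w le(2)] pair_xlog2_phi[OF w, of r] assms
    by (simp add: distrib_left add_divide_distrib)
qed

text \<open>Each summand satisfies \<open>z ln (z / a) \<ge> z ln s + z - a s\<close>, with equality
  at \<open>z = a s\<close>; the value of \<open>s\<close> makes the linear terms cancel in the
  sum.\<close>

lemma log_sum_inequality:
  assumes "0 \<le> x" "0 \<le> y" "0 < u" "0 < v"
  shows "xlog2 (x + y) - (x + y) * log 2 (u + v) \<le> xlog2 x - x * log 2 u + (xlog2 y - y * log 2 v)"
proof (cases "x + y = 0")
  case True
  then have "x = 0" "y = 0" using assms by auto
  then show ?thesis by simp
next
  case False
  define s where "s = (x + y) / (u + v)"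
  have s: "0 < s" using assms False by (simp add: s_def)
  have tangent: "z * ln s + z - a * s \<le> z * ln z - z * ln a" if "0 \<le> z" "0 < a" for z a
  proof (cases "z = 0")
    case False
    then have z: "0 < z" using that by simp
    have "ln (a * s / z) \<le> a * s / z - 1" using s that z by (intro ln_le_minus_one) auto
    then have "z * (ln a + ln s - ln z) \<le> z * (a * s / z - 1)"
      using s that z by (intro mult_left_mono) (auto simp: ln_div ln_mult)
    then show ?thesis using z by (simp add: algebra_simps)
  qed (use s that in simp)
  have "u * s + v * s = (u + v) * s" by (simp add: algebra_simps)
  then have us: "u * s + v * s = x + y" using assms by (simp add: s_def)
  have "(x + y) * ln s \<le> x * ln x - x * ln u + (y * ln y - y * ln v)"
    using tangent[of x u] tangent[of y v] us assms by (simp add: algebra_simps)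
  moreover have "ln s = ln (x + y) - ln (u + v)"
    using assms False by (simp add: s_def ln_div)
  ultimately have "((x + y) * ln (x + y) - (x + y) * ln (u + v)) / ln 2
      \<le> (x * ln x - x * ln u + (y * ln y - y * ln v)) / ln 2"
    by (intro divide_right_mono) (auto simp: algebra_simps)
  then show ?thesis by (simp add: xlog2_def log_def diff_divide_distrib add_divide_distrib)
qed

text \<open>\<open>pair_xlog2 w \<tau> - pair_xlog2 w 0\<close> is the relative entropy of the pair
  \<open>(w + \<tau>) / 2\<close>, \<open>(w - \<tau>) / 2\<close> with respect to
  \<open>w / 2\<close>, \<open>w / 2\<close>; the log-sum inequality applies to each component. A
  block of weight 0 has \<open>\<tau> = 0\<close> and contributes nothing.\<close>

lemma pair_xlog2_joint_convex:
  assumes "0 \<le> w" "0 \<le> w'" "\<bar>\<tau>\<bar> \<le> w" "\<bar>\<tau>'\<bar> \<le> w'"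
  shows "pair_xlog2 (w + w') (\<tau> + \<tau>') - pair_xlog2 (w + w') 0
    \<le> pair_xlog2 w \<tau> - pair_xlog2 w 0 + (pair_xlog2 w' \<tau>' - pair_xlog2 w' 0)"
proof (cases "w = 0 \<or> w' = 0")
  case True
  then show ?thesis using assms by auto
next
  case False
  then have w: "0 < w / 2" "0 < w' / 2" using assms by auto
  have z: "pair_xlog2 u 0 = u * log 2 (u / 2)" for u by (simp add: pair_xlog2_def xlog2_def)
  have "xlog2 ((w + \<tau>) / 2 + (w' + \<tau>') / 2) - ((w + \<tau>) / 2 + (w' + \<tau>') / 2) * log 2 (w / 2 + w' / 2)
      \<le> xlog2 ((w + \<tau>) / 2) - (w + \<tau>) / 2 * log 2 (w / 2) + (xlog2 ((w' + \<tau>') / 2) - (w' + \<tau>') / 2 * log 2 (w' / 2))"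
    using assms w by (intro log_sum_inequality) auto
  moreover have "xlog2 ((w - \<tau>) / 2 + (w' - \<tau>') / 2) - ((w - \<tau>) / 2 + (w' - \<tau>') / 2) * log 2 (w / 2 + w' / 2)
      \<le> xlog2 ((w - \<tau>) / 2) - (w - \<tau>) / 2 * log 2 (w / 2) + (xlog2 ((w' - \<tau>') / 2) - (w' - \<tau>') / 2 * log 2 (w' / 2))"
    using assms w by (intro log_sum_inequality) auto
  moreover have e: "(w + \<tau>) / 2 + (w' + \<tau>') / 2 = (w + w' + (\<tau> + \<tau>')) / 2"
    "(w - \<tau>) / 2 + (w' - \<tau>') / 2 = (w + w' - (\<tau> + \<tau>')) / 2" "w / 2 + w' / 2 = (w + w') / 2"
    by (auto simp: field_simps)
  ultimately have "xlog2 ((w + w' + (\<tau> + \<tau>')) / 2) + xlog2 ((w + w' - (\<tau> + \<tau>')) / 2)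
      - ((w + w' + (\<tau> + \<tau>')) / 2 + (w + w' - (\<tau> + \<tau>')) / 2) * log 2 ((w + w') / 2)
      \<le> xlog2 ((w + \<tau>) / 2) + xlog2 ((w - \<tau>) / 2) - ((w + \<tau>) / 2 + (w - \<tau>) / 2) * log 2 (w / 2)
       + (xlog2 ((w' + \<tau>') / 2) + xlog2 ((w' - \<tau>') / 2) - ((w' + \<tau>') / 2 + (w' - \<tau>') / 2) * log 2 (w' / 2))"
    unfolding e by (simp only: distrib_right)
  moreover have "(u + t) / 2 + (u - t) / 2 = u" for u t :: real by (simp add: field_simps)
  ultimately show ?thesis unfolding z by (simp add: pair_xlog2_def)
qed

section \<open>Coherence of X-shaped matrices\<close>

lemma sum_lessThan_4: "(\<Sum>i<4. f i) = f 0 + f 1 + f 2 + f (3::nat)"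
  by (simp add: eval_nat_numeral)

lemma all_less_4: "(\<forall>i<4. P i) \<longleftrightarrow> P 0 \<and> P 1 \<and> P 2 \<and> P (3::nat)"
  by (auto simp: eval_nat_numeral less_Suc_eq)

definition mat4 :: "complex list list \<Rightarrow> complex mat" where
  "mat4 xss = mat 4 4 (\<lambda>(i, j). xss ! i ! j)"

lemma mat4_carrier [simp]: "mat4 xss \<in> carrier_mat 4 4"
  by (simp add: mat4_def)

lemma dim_mat4 [simp]: "dim_row (mat4 xss) = 4" "dim_col (mat4 xss) = 4"
  by (simp_all add: mat4_def)

lemma index_mat4 [simp]: "i < 4 \<Longrightarrow> j < 4 \<Longrightarrow> mat4 xss $$ (i, j) = xss ! i ! j"
  by (simp add: mat4_def)

lemma mat4_eqI:
  assumes "A \<in> carrier_mat 4 4" "B \<in> carrier_mat 4 4" "\<forall>i<4. \<forall>j<4. A $$ (i, j) = B $$ (i, j)"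
  shows "A = B"
  using assms by (intro eq_matI) auto

text \<open>In the order 00, 01, 10, 11 the arguments \<open>a b c\<close> form the block on 00 and
  11, and \<open>p r q\<close> the one on 01 and 10.\<close>

definition x_mat :: "real \<Rightarrow> real \<Rightarrow> complex \<Rightarrow> real \<Rightarrow> real \<Rightarrow> complex \<Rightarrow> complex mat" where
  "x_mat a b c p r q = mat4
     [[complex_of_real a, 0, 0, c],
      [0, complex_of_real p, q, 0],
      [0, cnj q, complex_of_real r, 0],
      [cnj c, 0, 0, complex_of_real b]]"

text \<open>The eigenvalue difference of the block, which is also the length of its unnormalized
  Bloch vector.\<close>

definition gap :: "real \<Rightarrow> real \<Rightarrow> complex \<Rightarrow> real" where
  "gap a b c = sqrt ((a - b)\<^sup>2 + 4 * (cmod c)\<^sup>2)"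

text \<open>The upper bound is nonnegativity of the smaller eigenvalue, ensured by the determinant
  condition.\<close>

lemma gap_bounds:
  assumes "0 \<le> a" "0 \<le> b" "(cmod c)\<^sup>2 \<le> a * b"
  shows "0 \<le> gap a b c" "gap a b c \<le> a + b"
proof -
  show "0 \<le> gap a b c" by (simp add: gap_def)
  have "(a - b)\<^sup>2 + 4 * (cmod c)\<^sup>2 \<le> (a + b)\<^sup>2" using assms(3) by (simp add: power2_eq_square algebra_simps)
  then have "gap a b c \<le> sqrt ((a + b)\<^sup>2)" unfolding gap_def by (rule real_sqrt_le_mono)
  then show "gap a b c \<le> a + b" using assms by simp
qed

text \<open>Bloch vector of the block \<open>[[a, c], [c\<^sup>*, b]]\<close>: the eigenvector \<open>(u, v)\<close> of the larger
  eigenvalue has \<open>|u|\<^sup>2 - |v|\<^sup>2 = (a - b) / gap\<close> and \<open>u v\<^sup>* = c / gap\<close>.\<close>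

lemma block_eigenvectors:
  obtains u v :: complex where
    "u * cnj u + v * cnj v = 1"
    "complex_of_real a = complex_of_real ((a + b + gap a b c) / 2) * (u * cnj u)
      + complex_of_real ((a + b - gap a b c) / 2) * (v * cnj v)"
    "complex_of_real b = complex_of_real ((a + b + gap a b c) / 2) * (v * cnj v)
      + complex_of_real ((a + b - gap a b c) / 2) * (u * cnj u)"
    "c = complex_of_real (gap a b c) * (u * cnj v)"
proof -
  define g where "g = gap a b c"
  have g2: "g\<^sup>2 = (a - b)\<^sup>2 + 4 * (cmod c)\<^sup>2" "0 \<le> g" by (simp_all add: g_def gap_def)
  have "\<exists>u v :: complex. (cmod u)\<^sup>2 + (cmod v)\<^sup>2 = 1 \<and> g * ((cmod u)\<^sup>2 - (cmod v)\<^sup>2) = a - b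
      \<and> c = complex_of_real g * (u * cnj v)"
  proof (cases "g = 0")
    case True
    then have "(a - b)\<^sup>2 + 4 * (cmod c)\<^sup>2 = 0" using g2 by simp
    then have "a = b" "c = 0" by (auto simp: add_nonneg_eq_0_iff)
    then show ?thesis using True by (intro exI[of _ 1] exI[of _ 0]) simp
  next
    case False
    then have g: "0 < g" using g2 by simp
    define z where "z = (a - b) / g"
    have "z\<^sup>2 + 4 * (cmod c)\<^sup>2 / g\<^sup>2 = ((a - b)\<^sup>2 + 4 * (cmod c)\<^sup>2) / g\<^sup>2"
      by (simp add: z_def power_divide add_divide_distrib)
    also have "\<dots> = 1" unfolding g2(1)[symmetric] using g by simp
    finally have zc: "z\<^sup>2 + 4 * (cmod c)\<^sup>2 / g\<^sup>2 = 1" .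
    have "0 \<le> 4 * (cmod c)\<^sup>2 / g\<^sup>2" by simp
    then have z1: "z\<^sup>2 \<le> 1" using zc by linarith
    show ?thesis
    \<comment> \<open>Here the eigenvector is the second basis vector; otherwise \<open>u\<close>
      can be taken real and positive, and \<open>c = g * u * cnj v\<close> determines
      \<open>v\<close>.\<close>
    proof (cases "z = - 1")
      case True
      then have "c = 0" "a - b = - g" using zc g by (auto simp: z_def divide_simps)
      then show ?thesis by (intro exI[of _ 0] exI[of _ 1]) simp
    next
      case False
      have "\<bar>z\<bar> \<le> 1" using z1 abs_le_square_iff[of z 1] by simp
      then have z: "0 < 1 + z" using False by linarith
      define x where "x = sqrt ((1 + z) / 2)"
      have x: "x\<^sup>2 = (1 + z) / 2" "0 < x" using z by (simp_all add: x_def)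
      let ?v = "cnj c / complex_of_real (g * x)"
      have cg: "(cmod c)\<^sup>2 / g\<^sup>2 = (1 + z) * (1 - z) / 4" using zc by (simp add: power2_eq_square algebra_simps)
      have "(cmod ?v)\<^sup>2 = (cmod c)\<^sup>2 / g\<^sup>2 / x\<^sup>2"
        by (simp add: norm_divide norm_mult power_divide power_mult_distrib)
      also have "\<dots> = ((1 + z) * (1 - z) / 4) / ((1 + z) / 2)" unfolding cg x(1) ..
      also have "\<dots> = (1 - z) / 2" using z by (simp add: divide_simps)
      finally have v: "(cmod ?v)\<^sup>2 = (1 - z) / 2" .
      show ?thesis
      proof (rule exI[of _ "complex_of_real x"], rule exI[of _ ?v], intro conjI)
        have cx: "(cmod (complex_of_real x))\<^sup>2 = (1 + z) / 2" using x by simp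
        show "(cmod (complex_of_real x))\<^sup>2 + (cmod ?v)\<^sup>2 = 1"
          unfolding cx v by (simp add: field_simps)
        have "(1 + z) / 2 - (1 - z) / 2 = z" by (simp add: field_simps)
        then show "g * ((cmod (complex_of_real x))\<^sup>2 - (cmod ?v)\<^sup>2) = a - b"
          unfolding cx v using g by (simp add: z_def)
        show "c = complex_of_real g * (complex_of_real x * cnj ?v)" using x g by simp
      qed
    qed
  qed
  then obtain u v :: complex where uv: "(cmod u)\<^sup>2 + (cmod v)\<^sup>2 = 1" "g * ((cmod u)\<^sup>2 - (cmod v)\<^sup>2) = a - b"
    "c = complex_of_real g * (u * cnj v)" by blast
  have eqs: "a = (a + b + g) / 2 * (cmod u)\<^sup>2 + (a + b - g) / 2 * (cmod v)\<^sup>2"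
    "b = (a + b + g) / 2 * (cmod v)\<^sup>2 + (a + b - g) / 2 * (cmod u)\<^sup>2"
  proof -
    have "(a + b + g) / 2 * (cmod u)\<^sup>2 + (a + b - g) / 2 * (cmod v)\<^sup>2
        = (a + b) / 2 * ((cmod u)\<^sup>2 + (cmod v)\<^sup>2) + g * ((cmod u)\<^sup>2 - (cmod v)\<^sup>2) / 2" by (simp add: field_simps)
    then show "a = (a + b + g) / 2 * (cmod u)\<^sup>2 + (a + b - g) / 2 * (cmod v)\<^sup>2"
      unfolding uv(1,2) by (simp add: add_divide_distrib diff_divide_distrib)
    have "(a + b + g) / 2 * (cmod v)\<^sup>2 + (a + b - g) / 2 * (cmod u)\<^sup>2
        = (a + b) / 2 * ((cmod u)\<^sup>2 + (cmod v)\<^sup>2) - g * ((cmod u)\<^sup>2 - (cmod v)\<^sup>2) / 2" by (simp add: field_simps)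
    then show "b = (a + b + g) / 2 * (cmod v)\<^sup>2 + (a + b - g) / 2 * (cmod u)\<^sup>2"
      unfolding uv(1,2) by (simp add: add_divide_distrib diff_divide_distrib)
  qed
  show ?thesis
  proof (rule that[of u v])
    show "u * cnj u + v * cnj v = 1"
      using uv(1) by (simp flip: complex_norm_square of_real_power of_real_add)
    show "complex_of_real a = complex_of_real ((a + b + gap a b c) / 2) * (u * cnj u)
      + complex_of_real ((a + b - gap a b c) / 2) * (v * cnj v)"
      unfolding complex_norm_square[symmetric] g_def[symmetric] of_real_mult[symmetric] of_real_add[symmetric] of_real_eq_iff
      by (rule eqs)
    show "complex_of_real b = complex_of_real ((a + b + gap a b c) / 2) * (v * cnj v)
      + complex_of_real ((a + b - gap a b c) / 2) * (u * cnj u)"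
      unfolding complex_norm_square[symmetric] g_def[symmetric] of_real_mult[symmetric] of_real_add[symmetric] of_real_eq_iff
      by (rule eqs)
    show "c = complex_of_real (gap a b c) * (u * cnj v)" using uv(3) by (simp add: g_def)
  qed
qed

text \<open>Beside \<open>(u, v)\<close> a block has the orthogonal eigenvector
  \<open>(- cnj v, cnj u)\<close>. Columns 0 and 3 of \<open>U\<close> serve the outer block,
  columns 1 and 2 the inner one, hence the order of the eigenvalues.\<close>

lemma x_mat_diagonalizes:
  obtains U where "diagonalizes 4 U (\<lambda>i. [(a + b + gap a b c) / 2, (p + r + gap p r q) / 2,
      (p + r - gap p r q) / 2, (a + b - gap a b c) / 2] ! i) (x_mat a b c p r q)"
proof -
  obtain u v where uv: "u * cnj u + v * cnj v = 1"
    "complex_of_real a = complex_of_real ((a + b + gap a b c) / 2) * (u * cnj u)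
      + complex_of_real ((a + b - gap a b c) / 2) * (v * cnj v)"
    "complex_of_real b = complex_of_real ((a + b + gap a b c) / 2) * (v * cnj v)
      + complex_of_real ((a + b - gap a b c) / 2) * (u * cnj u)"
    "c = complex_of_real (gap a b c) * (u * cnj v)" using block_eigenvectors .
  obtain s t where st: "s * cnj s + t * cnj t = 1"
    "complex_of_real p = complex_of_real ((p + r + gap p r q) / 2) * (s * cnj s)
      + complex_of_real ((p + r - gap p r q) / 2) * (t * cnj t)"
    "complex_of_real r = complex_of_real ((p + r + gap p r q) / 2) * (t * cnj t)
      + complex_of_real ((p + r - gap p r q) / 2) * (s * cnj s)"
    "q = complex_of_real (gap p r q) * (s * cnj t)" using block_eigenvectors .
  have gap: "complex_of_real ((x + y + g) / 2) * z - complex_of_real ((x + y - g) / 2) * z = complex_of_real g * z"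
    for x y g :: real and z
    by (simp add: algebra_simps add_divide_distrib diff_divide_distrib)
  define l1 l2 l3 l4 where "l1 = (a + b + gap a b c) / 2" and "l2 = (p + r + gap p r q) / 2"
    and "l3 = (p + r - gap p r q) / 2" and "l4 = (a + b - gap a b c) / 2"
  have c: "c = complex_of_real l1 * (u * cnj v) - complex_of_real l4 * (u * cnj v)"
    unfolding l1_def l4_def gap by (rule uv(4))
  have q: "q = complex_of_real l2 * (s * cnj t) - complex_of_real l3 * (s * cnj t)"
    unfolding l2_def l3_def gap by (rule st(4))
  note eqs = uv(2,3)[folded l1_def l4_def] st(2,3)[folded l2_def l3_def]
  have cc: "cnj c = complex_of_real l1 * (cnj u * v) - complex_of_real l4 * (cnj u * v)"
    "cnj q = complex_of_real l2 * (cnj s * t) - complex_of_real l3 * (cnj s * t)"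
    by (subst c, simp) (subst q, simp)
  have "diagonalizes 4 (mat4 [[u, 0, 0, - cnj v], [0, s, - cnj t, 0], [0, t, cnj s, 0], [v, 0, 0, cnj u]])
    (\<lambda>i. [l1, l2, l3, l4] ! i) (x_mat a b c p r q)"
    unfolding diagonalizes_iff all_less_4 sum_lessThan_4
    using uv(1) st(1) eqs c q cc by (simp add: x_mat_def algebra_simps)
  then show ?thesis using that unfolding l1_def l2_def l3_def l4_def by blast
qed

text \<open>The entropy of the diagonal minus the entropy of the block, without normalization:
  \<open>pair_xlog2 (a + b) (a - b)\<close> is \<open>xlog2 a + xlog2 b\<close>.\<close>

definition block_coherence :: "real \<Rightarrow> real \<Rightarrow> complex \<Rightarrow> real" where
  "block_coherence a b c = pair_xlog2 (a + b) (gap a b c) - pair_xlog2 (a + b) (a - b)"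

lemma coherence_x_mat: "coherence (x_mat a b c p r q) = block_coherence a b c + block_coherence p r q"
proof -
  obtain U where U: "diagonalizes 4 U (\<lambda>i. [(a + b + gap a b c) / 2, (p + r + gap p r q) / 2,
      (p + r - gap p r q) / 2, (a + b - gap a b c) / 2] ! i) (x_mat a b c p r q)"
    using x_mat_diagonalizes .
  have "diagonal_part (x_mat a b c p r q) = mat_diag 4 (\<lambda>i. complex_of_real ([a, p, r, b] ! i))"
    by (rule mat4_eqI) (auto simp: diagonal_part_def x_mat_def all_less_4 mat_diag_def)
  then have "von_neumann_entropy (diagonal_part (x_mat a b c p r q)) = - (xlog2 a + xlog2 b + xlog2 p + xlog2 r)"
    by (simp add: entropy_mat_diag sum_lessThan_4)
  then show ?thesis
    by (simp add: coherence_def entropy_diagonalizes[OF U] sum_lessThan_4 block_coherence_def pair_xlog2_def)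
qed

lemma randomness_x_mat:
  assumes "0 \<le> a" "0 \<le> b" "(cmod c)\<^sup>2 \<le> a * b" "0 \<le> p" "0 \<le> r" "(cmod q)\<^sup>2 \<le> p * r"
  shows "randomness (x_mat a b c p r q) = coherence (x_mat a b c p r q)"
proof -
  obtain U where U: "diagonalizes 4 U (\<lambda>i. [(a + b + gap a b c) / 2, (p + r + gap p r q) / 2,
      (p + r - gap p r q) / 2, (a + b - gap a b c) / 2] ! i) (x_mat a b c p r q)"
    using x_mat_diagonalizes .
  have "\<forall>i<4. 0 \<le> [(a + b + gap a b c) / 2, (p + r + gap p r q) / 2,
      (p + r - gap p r q) / 2, (a + b - gap a b c) / 2] ! i"
    using gap_bounds[OF assms(1-3)] gap_bounds[OF assms(4-6)] assms by (simp add: all_less_4)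
  then show ?thesis using randomness_eq_coherence[OF U] by blast
qed

lemma gap_scale: "0 < k \<Longrightarrow> gap (k * a) (k * b) (complex_of_real k * c) = k * gap a b c"
proof -
  assume k: "0 < k"
  have "(k * a - k * b)\<^sup>2 + 4 * (cmod (complex_of_real k * c))\<^sup>2 = k\<^sup>2 * ((a - b)\<^sup>2 + 4 * (cmod c)\<^sup>2)"
    by (simp add: norm_mult power_mult_distrib algebra_simps power2_eq_square)
  then show ?thesis using k by (simp add: gap_def real_sqrt_mult)
qed

text \<open>The corrections from \<open>pair_xlog2_scale\<close> cancel. This homogeneity lets the
  weight of a block undo the normalization of the postselected state.\<close>

lemma block_coherence_scale:
  assumes "0 < k" "0 \<le> a" "0 \<le> b" "(cmod c)\<^sup>2 \<le> a * b"
  shows "block_coherence (k * a) (k * b) (complex_of_real k * c) = k * block_coherence a b c"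
proof -
  have "pair_xlog2 (k * (a + b)) (k * gap a b c) = k * pair_xlog2 (a + b) (gap a b c) + (a + b) * xlog2 k"
    using assms gap_bounds[OF assms(2-4)] by (intro pair_xlog2_scale) auto
  moreover have "pair_xlog2 (k * (a + b)) (k * (a - b)) = k * pair_xlog2 (a + b) (a - b) + (a + b) * xlog2 k"
    using assms by (intro pair_xlog2_scale) auto
  ultimately show ?thesis
    unfolding block_coherence_def gap_scale[OF assms(1)] distrib_left[symmetric] right_diff_distrib[symmetric]
    by (simp add: right_diff_distrib)
qed

lemma block_coherence_0 [simp]: "block_coherence 0 0 0 = 0"
  by (simp add: block_coherence_def gap_def)

text \<open>\<open>2 * Re c\<close> is the x component of a Bloch vector of length
  \<open>gap a b c\<close>.\<close>

lemma two_Re_le: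
  assumes "0 \<le> a" "0 \<le> b" "(cmod c)\<^sup>2 \<le> a * b"
  shows "\<bar>2 * Re c\<bar> \<le> a + b"
proof -
  have "(Re c)\<^sup>2 \<le> (cmod c)\<^sup>2" by (simp add: cmod_def)
  moreover have "(2 * Re c)\<^sup>2 = 4 * (Re c)\<^sup>2" "(gap a b c)\<^sup>2 = (a - b)\<^sup>2 + 4 * (cmod c)\<^sup>2"
    by (simp_all add: gap_def power_mult_distrib)
  ultimately have "(2 * Re c)\<^sup>2 \<le> (gap a b c)\<^sup>2"
    using zero_le_power2[of "a - b"] by linarith
  then have "\<bar>2 * Re c\<bar> \<le> \<bar>gap a b c\<bar>" by (simp only: abs_le_square_iff)
  then show ?thesis using gap_bounds[OF assms] by simp
qed

text \<open>Superadditivity for the z component \<open>a - b\<close>, the x component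
  \<open>2 * Re c\<close> and the length \<open>gap a b c\<close>; the y component is dropped from
  the sum of squares.\<close>

lemma block_coherence_ge:
  assumes "0 \<le> a" "0 \<le> b" "(cmod c)\<^sup>2 \<le> a * b"
  shows "pair_xlog2 (a + b) (2 * Re c) - pair_xlog2 (a + b) 0 \<le> block_coherence a b c"
proof -
  have "(Re c)\<^sup>2 \<le> (cmod c)\<^sup>2" by (simp add: cmod_def)
  then have "(a - b)\<^sup>2 + (2 * Re c)\<^sup>2 \<le> (gap a b c)\<^sup>2" by (simp add: gap_def power_mult_distrib)
  then have "pair_xlog2 (a + b) (a - b) + pair_xlog2 (a + b) (2 * Re c) \<le> pair_xlog2 (a + b) (gap a b c) + pair_xlog2 (a + b) 0"
    using assms gap_bounds[OF assms] by (intro pair_xlog2_superadditive) auto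
  then show ?thesis by (simp add: block_coherence_def)
qed

lemma pair_xlog2_binary_entropy: "pair_xlog2 1 (1 - 2 * e) - pair_xlog2 1 0 = 1 - binary_entropy e"
proof -
  have e: "(1 + (1 - 2 * e)) / 2 = 1 - e" "(1 - (1 - 2 * e)) / 2 = e" by simp_all
  show ?thesis
    unfolding pair_xlog2_def e by (simp add: xlog2_def binary_entropy_def log_divide)
qed

lemma coherence_x_mat_ge:
  assumes "0 \<le> a" "0 \<le> b" "(cmod c)\<^sup>2 \<le> a * b" "0 \<le> p" "0 \<le> r" "(cmod q)\<^sup>2 \<le> p * r"
    and "a + b + p + r = 1" "2 * Re c + 2 * Re q = 1 - 2 * e"
  shows "1 - binary_entropy e \<le> coherence (x_mat a b c p r q)"
proof -
  have "pair_xlog2 (a + b + (p + r)) (2 * Re c + 2 * Re q) - pair_xlog2 (a + b + (p + r)) 0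
      \<le> pair_xlog2 (a + b) (2 * Re c) - pair_xlog2 (a + b) 0 + (pair_xlog2 (p + r) (2 * Re q) - pair_xlog2 (p + r) 0)"
    using assms two_Re_le[OF assms(1-3)] two_Re_le[OF assms(4-6)] by (intro pair_xlog2_joint_convex) auto
  moreover have "a + b + (p + r) = 1" using assms by simp
  ultimately show ?thesis
    using block_coherence_ge[OF assms(1-3)] block_coherence_ge[OF assms(4-6)]
    unfolding coherence_x_mat by (simp add: assms(8) pair_xlog2_binary_entropy)
qed

text \<open>With equal diagonal entries and a real off-diagonal entry the Bloch vector points along
  x, and \<open>block_coherence_ge\<close> is attained. The case of trace 1 is scaled by
  \<open>w\<close>.\<close>

lemma block_coherence_symmetric:
  assumes "0 \<le> w" "0 \<le> e" "e \<le> 1"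
  shows "block_coherence (w / 2) (w / 2) (complex_of_real (w * (1 - 2 * e) / 2)) = w * (1 - binary_entropy e)"
proof (cases "w = 0")
  case False
  then have w: "0 < w" using assms by simp
  have gap: "gap (1 / 2) (1 / 2) (complex_of_real ((1 - 2 * e) / 2)) = \<bar>1 - 2 * e\<bar>"
    by (simp add: gap_def norm_divide power_divide real_sqrt_abs del: of_real_divide of_real_diff)
  have "(1 - 2 * e)\<^sup>2 \<le> 1\<^sup>2" using assms by (intro abs_le_square_iff[THEN iffD1]) auto
  then have "block_coherence (w * (1 / 2)) (w * (1 / 2)) (complex_of_real w * complex_of_real ((1 - 2 * e) / 2))
      = w * block_coherence (1 / 2) (1 / 2) (complex_of_real ((1 - 2 * e) / 2))"
    using w by (intro block_coherence_scale) (auto simp: norm_divide power_divide simp del: of_real_divide of_real_diff)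
  moreover have "block_coherence (1 / 2) (1 / 2) (complex_of_real ((1 - 2 * e) / 2)) = 1 - binary_entropy e"
    unfolding block_coherence_def gap by (simp add: pair_xlog2_binary_entropy)
  ultimately show ?thesis by simp
qed simp

section \<open>The two-qubit protocol\<close>

lemma Pi_plus_eq: "Pi_plus = mat_diag 4 (\<lambda>i. [1, 0, 0, 1] ! i)"
  and Pi_minus_eq: "Pi_minus = mat_diag 4 (\<lambda>i. [0, 1, 1, 0] ! i)"
  unfolding Pi_plus_def Pi_minus_def proj2_def ketbra_def tensor_vec_def ket0_def ket1_def
  by (rule mat4_eqI; simp add: all_less_4 mat_diag_def carrier_matI unit_vec_def)+

lemma Pi_x_minus_eq: "Pi_x_minus = mat4
    [[1 / 2, 0, 0, - 1 / 2], [0, 1 / 2, - 1 / 2, 0], [0, - 1 / 2, 1 / 2, 0], [- 1 / 2, 0, 0, 1 / 2]]"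
proof -
  have s: "complex_of_real (sqrt 2) * complex_of_real (sqrt 2) = 2"
    by (simp flip: of_real_mult)
  have s4: "complex_of_real (sqrt 2) * (complex_of_real (sqrt 2) * (complex_of_real (sqrt 2) * complex_of_real (sqrt 2))) = 4"
    by (simp add: s)
  show ?thesis
    unfolding Pi_x_minus_def proj2_def ketbra_def tensor_vec_def ket_plus_def ket_minus_def ket0_def ket1_def
    by (rule mat4_eqI) (simp_all add: all_less_4 carrier_matI unit_vec_def s s4 mult.assoc)
qed

lemma flip_B_eq: "flip_B = mat4 [[0, 1, 0, 0], [1, 0, 0, 0], [0, 0, 0, 1], [0, 0, 1, 0]]"
  unfolding flip_B_def tensor_mat_def ketbra_def ket0_def ket1_def
  by (rule mat4_eqI) (simp_all add: all_less_4 carrier_matI unit_vec_def)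

text \<open>Testing positivity on vectors supported on two basis vectors bounds the 2 by 2 principal
  minors.\<close>

lemma density_operator_4_entries:
  assumes "density_operator 4 \<rho>"
  obtains a b p r c q where
    "\<rho> $$ (0, 0) = complex_of_real a" "\<rho> $$ (3, 3) = complex_of_real b" "\<rho> $$ (0, 3) = c" "\<rho> $$ (3, 0) = cnj c"
    "\<rho> $$ (1, 1) = complex_of_real p" "\<rho> $$ (2, 2) = complex_of_real r" "\<rho> $$ (1, 2) = q" "\<rho> $$ (2, 1) = cnj q"
    "0 \<le> a" "0 \<le> b" "(cmod c)\<^sup>2 \<le> a * b" "0 \<le> p" "0 \<le> r" "(cmod q)\<^sup>2 \<le> p * r" "a + b + p + r = 1"
proof -
  have R: "\<rho> \<in> carrier_mat 4 4" and H: "mat_adjoint \<rho> = \<rho>" and tr: "mat_trace \<rho> = 1"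
    and pos: "\<And>v. v \<in> carrier_vec 4 \<Longrightarrow> 0 \<le> (\<rho> *\<^sub>v v) \<bullet>c v"
    using assms by (auto simp: density_operator_def)
  note [simp] = carrier_matD[OF R]
  have sym: "\<rho> $$ (j, i) = cnj (\<rho> $$ (i, j))" if "i < 4" "j < 4" for i j
    using that index_adjoint[of j \<rho> i] by (simp add: H)
  have quad: "0 \<le> \<rho> $$ (i, i) * (x * cnj x) + \<rho> $$ (i, j) * (y * cnj x) + \<rho> $$ (j, i) * (x * cnj y) + \<rho> $$ (j, j) * (y * cnj y)"
    if ij: "i < 4" "j < 4" "i \<noteq> j" for i j x y
  proof -
    let ?v = "vec 4 (\<lambda>k. if k = i then x else if k = j then y else 0)"
    have mv: "(\<rho> *\<^sub>v ?v) $ k = \<rho> $$ (k, i) * x + \<rho> $$ (k, j) * y" if "k < 4" for k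
    proof -
      have "(\<rho> *\<^sub>v ?v) $ k = (\<Sum>l<4. \<rho> $$ (k, l) * (if l = i then x else if l = j then y else 0))"
        using that by (simp add: scalar_prod_def atLeast0LessThan)
      also have "\<dots> = (\<Sum>l<4. (if l = i then \<rho> $$ (k, i) * x else 0) + (if l = j then \<rho> $$ (k, j) * y else 0))"
        using ij by (intro sum.cong) auto
      also have "\<dots> = \<rho> $$ (k, i) * x + \<rho> $$ (k, j) * y" using ij by (simp add: sum.distrib)
      finally show ?thesis .
    qed
    have "(\<rho> *\<^sub>v ?v) \<bullet>c ?v = (\<Sum>l<4. (if l = i then (\<rho> *\<^sub>v ?v) $ i * cnj x else 0)
        + (if l = j then (\<rho> *\<^sub>v ?v) $ j * cnj y else 0))"
      using ij unfolding scalar_prod_def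
      by (intro sum.cong) (auto simp: atLeast0LessThan conjugate_complex_def simp del: index_mult_mat_vec)
    also have "\<dots> = (\<rho> *\<^sub>v ?v) $ i * cnj x + (\<rho> *\<^sub>v ?v) $ j * cnj y"
      using ij by (simp add: sum.distrib del: index_mult_mat_vec)
    finally have "(\<rho> *\<^sub>v ?v) \<bullet>c ?v = (\<rho> *\<^sub>v ?v) $ i * cnj x + (\<rho> *\<^sub>v ?v) $ j * cnj y" .
    then show ?thesis using pos[of ?v] ij by (simp add: mv algebra_simps del: index_mult_mat_vec)
  qed
  have diag: "\<rho> $$ (i, i) = complex_of_real (Re (\<rho> $$ (i, i)))" if "i < 4" for i
    using sym[OF that that] by (simp add: complex_eq_iff)
  have minor: "0 \<le> Re (\<rho> $$ (i, i)) \<and> (cmod (\<rho> $$ (i, j)))\<^sup>2 \<le> Re (\<rho> $$ (i, i)) * Re (\<rho> $$ (j, j))"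
    if ij: "i < 4" "j < 4" "i \<noteq> j" for i j
  proof -
    define a b c where "a = Re (\<rho> $$ (i, i))" and "b = Re (\<rho> $$ (j, j))" and "c = \<rho> $$ (i, j)"
    have Q: "0 \<le> complex_of_real a * (x * cnj x) + c * (y * cnj x) + cnj c * (x * cnj y) + complex_of_real b * (y * cnj y)" for x y
      using quad[OF ij, of x y] sym[OF ij(1,2)] diag[OF ij(1)] diag[OF ij(2)] by (simp add: a_def b_def c_def)
    have a: "0 \<le> a" using Q[of 1 0] by (simp add: less_eq_complex_def)
    have b: "0 \<le> b" using Q[of 0 1] by (simp add: less_eq_complex_def)
    have N: "c * cnj c = complex_of_real ((cmod c)\<^sup>2)" by (simp only: complex_norm_square)
    \<comment> \<open>The test vector has components \<open>t\<close> and \<open>- cnj c\<close>,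
      which leaves a real polynomial in \<open>t\<close>; for \<open>b > 0\<close> the choice
      \<open>t = b\<close> gives the determinant bound.\<close>
    have "0 \<le> complex_of_real (t * t * a - 2 * t * (cmod c)\<^sup>2 + b * (cmod c)\<^sup>2)" for t
    proof -
      have "complex_of_real a * (complex_of_real t * cnj (complex_of_real t)) + c * (- cnj c * cnj (complex_of_real t))
          + cnj c * (complex_of_real t * cnj (- cnj c)) + complex_of_real b * (- cnj c * cnj (- cnj c))
        = complex_of_real t * complex_of_real t * complex_of_real a - 2 * complex_of_real t * (c * cnj c) + complex_of_real b * (c * cnj c)"
        by (simp add: algebra_simps)
      also have "\<dots> = complex_of_real (t * t * a - 2 * t * (cmod c)\<^sup>2 + b * (cmod c)\<^sup>2)"
        unfolding N by simp
      finally show ?thesis using Q[of "complex_of_real t" "- cnj c"] by (simp only:)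
    qed
    then have T: "0 \<le> t * t * a - 2 * t * (cmod c)\<^sup>2 + b * (cmod c)\<^sup>2" for t
      by (metis less_eq_complex_def Re_complex_of_real zero_complex.sel(1))
    have "(cmod c)\<^sup>2 \<le> a * b"
    proof (cases "b = 0")
      case False
      then have "0 < b" using b by simp
      moreover have "0 \<le> b * (a * b - (cmod c)\<^sup>2)" using T[of b] by (simp add: algebra_simps)
      ultimately show ?thesis by (simp add: zero_le_mult_iff)
    next
      case True
      define n where "n = (cmod c)\<^sup>2"
      have n: "0 \<le> n" by (simp add: n_def)
      have T': "2 * t * n \<le> t * t * a" for t using T[of t] True by (simp add: n_def)
      \<comment> \<open>The bound at \<open>t = n / a\<close>, or at \<open>t = 1\<close> if
        \<open>a = 0\<close>, forces \<open>n\<close> to vanish.\<close>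
      have "n \<le> 0"
      proof (cases "a = 0")
        case True
        then show ?thesis using T'[of 1] by simp
      next
        case False
        then have "2 * (n / a) * n \<le> (n / a) * (n / a) * a" using T'[of "n / a"] by simp
        then have "2 * (n * n) \<le> n * n" using False a by (simp add: divide_simps split: if_splits)
        then have "n * n \<le> 0" by simp
        then show ?thesis using n by (simp add: mult_le_0_iff)
      qed
      then show ?thesis using True by (simp add: n_def)
    qed
    then show ?thesis using a by (simp add: a_def b_def c_def)
  qed
  have "Re (mat_trace \<rho>) = 1" by (simp add: tr)
  then have tr': "Re (\<rho> $$ (0, 0)) + Re (\<rho> $$ (3, 3)) + Re (\<rho> $$ (1, 1)) + Re (\<rho> $$ (2, 2)) = 1"
    by (simp add: mat_trace_def sum_lessThan_4)
  show ?thesis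
    by (rule that[of "Re (\<rho> $$ (0, 0))" "Re (\<rho> $$ (3, 3))" "\<rho> $$ (0, 3)"
        "Re (\<rho> $$ (1, 1))" "Re (\<rho> $$ (2, 2))" "\<rho> $$ (1, 2)"])
      (use minor[of 0 3] minor[of 3 0] minor[of 1 2] minor[of 2 1] tr' diag[of 0] diag[of 1] diag[of 2] diag[of 3]
        sym[of 0 3] sym[of 1 2] in simp_all)
qed

text \<open>The quadratic form is the sum of \<open>d l\<close> times the squared modulus of the
  overlap of \<open>v\<close> with column \<open>l\<close> of \<open>U\<close>.\<close>

lemma diagonalizes_psd:
  assumes A: "diagonalizes n U d A" and d: "\<And>i. i < n \<Longrightarrow> 0 \<le> d i" and v: "v \<in> carrier_vec n"
  shows "0 \<le> (A *\<^sub>v v) \<bullet>c v"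
proof -
  have [simp]: "dim_row A = n" "dim_col A = n" "dim_vec v = n"
    using diagonalizesD(2)[OF A] v by auto
  have ent: "A $$ (i, j) = (\<Sum>l<n. complex_of_real (d l) * (U $$ (i, l) * cnj (U $$ (j, l))))" if "i < n" "j < n" for i j
    using A that by (simp add: diagonalizes_iff)
  define z where "z l = (\<Sum>i<n. U $$ (i, l) * cnj (v $ i))" for l
  have zz: "z l * cnj (z l) = (\<Sum>i<n. \<Sum>j<n. U $$ (i, l) * cnj (v $ i) * (cnj (U $$ (j, l)) * v $ j))" for l
    unfolding z_def cnj_sum sum_product by simp
  have "(A *\<^sub>v v) \<bullet>c v = (\<Sum>i<n. \<Sum>j<n. A $$ (i, j) * v $ j * cnj (v $ i))"
    by (simp add: scalar_prod_def atLeast0LessThan conjugate_complex_def sum_distrib_right)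
  also have "\<dots> = (\<Sum>i<n. \<Sum>j<n. \<Sum>l<n. complex_of_real (d l) * (U $$ (i, l) * cnj (v $ i) * (cnj (U $$ (j, l)) * v $ j)))"
    by (intro sum.cong refl) (simp add: ent sum_distrib_right sum_distrib_left ac_simps)
  also have "\<dots> = (\<Sum>i<n. \<Sum>l<n. \<Sum>j<n. complex_of_real (d l) * (U $$ (i, l) * cnj (v $ i) * (cnj (U $$ (j, l)) * v $ j)))"
    by (intro sum.cong refl sum.swap)
  also have "\<dots> = (\<Sum>l<n. \<Sum>i<n. \<Sum>j<n. complex_of_real (d l) * (U $$ (i, l) * cnj (v $ i) * (cnj (U $$ (j, l)) * v $ j)))"
    by (rule sum.swap)
  also have "\<dots> = (\<Sum>l<n. complex_of_real (d l) * (z l * cnj (z l)))"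
    by (simp only: zz sum_distrib_left)
  also have "\<dots> = complex_of_real (\<Sum>l<n. d l * (cmod (z l))\<^sup>2)"
    unfolding complex_norm_square[symmetric] by simp
  finally have "(A *\<^sub>v v) \<bullet>c v = complex_of_real (\<Sum>l<n. d l * (cmod (z l))\<^sup>2)" .
  moreover have "0 \<le> (\<Sum>l<n. d l * (cmod (z l))\<^sup>2)" using d by (intro sum_nonneg) auto
  ultimately show ?thesis by (simp add: less_eq_complex_def)
qed

lemma density_operator_x_mat:
  assumes "0 \<le> a" "0 \<le> b" "(cmod c)\<^sup>2 \<le> a * b" "0 \<le> p" "0 \<le> r" "(cmod q)\<^sup>2 \<le> p * r" "a + b + p + r = 1"
  shows "density_operator 4 (x_mat a b c p r q)"
proof -
  obtain U where U: "diagonalizes 4 U (\<lambda>i. [(a + b + gap a b c) / 2, (p + r + gap p r q) / 2,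
      (p + r - gap p r q) / 2, (a + b - gap a b c) / 2] ! i) (x_mat a b c p r q)"
    using x_mat_diagonalizes .
  have "\<forall>i<4. 0 \<le> [(a + b + gap a b c) / 2, (p + r + gap p r q) / 2,
      (p + r - gap p r q) / 2, (a + b - gap a b c) / 2] ! i"
    using gap_bounds[OF assms(1-3)] gap_bounds[OF assms(4-6)] assms by (simp add: all_less_4)
  then have "\<forall>v \<in> carrier_vec 4. 0 \<le> (x_mat a b c p r q *\<^sub>v v) \<bullet>c v"
    using diagonalizes_psd[OF U] by blast
  moreover have "mat_adjoint (x_mat a b c p r q) = x_mat a b c p r q"
    by (rule mat4_eqI) (simp_all add: x_mat_def all_less_4)
  moreover have "mat_trace (x_mat a b c p r q) = complex_of_real (a + b + p + r)"
    by (simp add: mat_trace_def x_mat_def sum_lessThan_4)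
  ultimately show ?thesis
    using assms(7) by (simp add: density_operator_def x_mat_def)
qed

lemma mat_trace_Pi_mult:
  assumes "A \<in> carrier_mat 4 4"
  shows "mat_trace (Pi_plus * A) = A $$ (0, 0) + A $$ (3, 3)"
    "mat_trace (Pi_minus * A) = A $$ (1, 1) + A $$ (2, 2)"
    "mat_trace (Pi_x_minus * A) = (A $$ (0, 0) + A $$ (3, 3) + A $$ (1, 1) + A $$ (2, 2)
       - A $$ (0, 3) - A $$ (3, 0) - A $$ (1, 2) - A $$ (2, 1)) / 2"
  using carrier_matD[OF assms]
  by (simp_all add: mat_trace_def Pi_plus_eq Pi_minus_eq Pi_x_minus_eq mat_diag_mult_left[OF assms] sum_lessThan_4
      index_mult_sum[where k = 4] add_divide_distrib diff_divide_distrib del: index_mult_mat(1))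

text \<open>Only entries within the parity blocks are named; those between the blocks, which
  \<open>Phi\<close> removes, stay arbitrary.\<close>

locale two_qubit_entries =
  fixes \<rho> :: "complex mat" and a b c p r q
  assumes carrier: "\<rho> \<in> carrier_mat 4 4"
    and entries: "\<rho> $$ (0, 0) = complex_of_real a" "\<rho> $$ (3, 3) = complex_of_real b"
      "\<rho> $$ (0, 3) = c" "\<rho> $$ (3, 0) = cnj c" "\<rho> $$ (1, 1) = complex_of_real p" "\<rho> $$ (2, 2) = complex_of_real r"
      "\<rho> $$ (1, 2) = q" "\<rho> $$ (2, 1) = cnj q"
begin

lemma Pi_conj:
  "Pi_plus * \<rho> * Pi_plus = x_mat a b c 0 0 0"
  "Pi_minus * \<rho> * Pi_minus = x_mat 0 0 0 p r q"
proof -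
  have D: "mat_diag 4 f * \<rho> * mat_diag 4 f = mat 4 4 (\<lambda>(i, j). f i * \<rho> $$ (i, j) * f j)" for f :: "nat \<Rightarrow> complex"
  proof -
    have "mat_diag 4 f * \<rho> \<in> carrier_mat 4 4" by (rule mult_carrier_mat[OF mat_diag_dim carrier])
    then show ?thesis
      by (subst mat_diag_mult_right) (auto simp: mat_diag_mult_left[OF carrier] intro!: eq_matI)
  qed
  show "Pi_plus * \<rho> * Pi_plus = x_mat a b c 0 0 0" "Pi_minus * \<rho> * Pi_minus = x_mat 0 0 0 p r q"
    unfolding Pi_plus_eq Pi_minus_eq D
    by (rule mat4_eqI; simp add: x_mat_def all_less_4 entries entries[unfolded One_nat_def])+
qed

lemma Phi_eq: "Phi \<rho> = x_mat a b c p r q"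
  unfolding Phi_def Pi_conj by (rule mat4_eqI) (simp_all add: x_mat_def all_less_4)

text \<open>The normalization appears as a factor to match \<open>block_coherence_scale\<close>. For
  \<open>a + b = 0\<close> both sides are the zero matrix, because \<open>1 / 0 = 0\<close>.\<close>

lemma post_state_plus:
  "post_state Pi_plus \<rho> = x_mat (1 / (a + b) * a) (1 / (a + b) * b) (complex_of_real (1 / (a + b)) * c) 0 0 0"
  unfolding post_state_def Pi_conj mat_trace_Pi_mult[OF carrier] entries
  by (rule mat4_eqI) (simp_all add: x_mat_def all_less_4)

text \<open>The flip moves the odd parity block to 00 and 11, which gives both terms of the key rate
  the same form.\<close>

lemma post_state_minus:
  "flip_B * post_state Pi_minus \<rho> * flip_B
    = x_mat (1 / (p + r) * p) (1 / (p + r) * r) (complex_of_real (1 / (p + r)) * q) 0 0 0"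
proof -
  have P: "post_state Pi_minus \<rho> = x_mat 0 0 0 (1 / (p + r) * p) (1 / (p + r) * r) (complex_of_real (1 / (p + r)) * q)"
    unfolding post_state_def Pi_conj mat_trace_Pi_mult[OF carrier] entries
    by (rule mat4_eqI) (simp_all add: x_mat_def all_less_4)
  have "flip_B * x_mat 0 0 0 x y z * flip_B = x_mat x y z 0 0 0" for x y z
    unfolding flip_B_eq
    by (rule mat4_eqI)
      (simp_all add: x_mat_def all_less_4 index_mult_sum[where k = 4] sum_lessThan_4
        mult_carrier_mat[where n = 4] del: index_mult_mat(1))
  then show ?thesis unfolding P .
qed

end

text \<open>Homogeneity cancels the weight against the normalization. At weight 0 the determinant
  condition forces \<open>c = 0\<close>, and both sides vanish.\<close>

lemma weighted_randomness:
  assumes "0 \<le> a" "0 \<le> b" "(cmod c)\<^sup>2 \<le> a * b"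
  shows "(a + b) * randomness (x_mat (1 / (a + b) * a) (1 / (a + b) * b) (complex_of_real (1 / (a + b)) * c) 0 0 0)
    = block_coherence a b c"
proof (cases "a + b = 0")
  case True
  then have "a = 0" "b = 0" using assms by auto
  then show ?thesis using assms by simp
next
  case False
  define k where "k = 1 / (a + b)"
  have k: "0 < k" "(a + b) * k = 1" using False assms by (auto simp: k_def)
  have "k * k * (cmod c)\<^sup>2 \<le> k * k * (a * b)" using k assms by (intro mult_left_mono) auto
  then have "(cmod (complex_of_real k * c))\<^sup>2 \<le> k * a * (k * b)"
    using k by (simp add: norm_mult power2_eq_square ac_simps)
  then have "randomness (x_mat (k * a) (k * b) (complex_of_real k * c) 0 0 0)
      = block_coherence (k * a) (k * b) (complex_of_real k * c)"
    using k assms by (simp add: randomness_x_mat coherence_x_mat)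
  also have "\<dots> = k * block_coherence a b c" using block_coherence_scale[OF k(1) assms] .
  finally show ?thesis using k(2) unfolding k_def[symmetric] by (simp flip: mult.assoc)
qed

text \<open>The weights \<open>1 - e\<^sub>b\<close> and \<open>e\<^sub>b\<close> are the traces of
  the two blocks, so the terms of \<open>sifted_randomness\<close> are the block coherences.\<close>

lemma sifted_randomness_eq_coherence_Phi:
  assumes "\<rho> \<in> bb84_states e\<^sub>b e\<^sub>p"
  shows "sifted_randomness e\<^sub>b \<rho> = coherence (Phi \<rho>)" "1 - binary_entropy e\<^sub>p \<le> coherence (Phi \<rho>)"
proof -
  have dens: "density_operator 4 \<rho>" and tb: "mat_trace (Pi_minus * \<rho>) = complex_of_real e\<^sub>b"
    and tp: "mat_trace (Pi_x_minus * \<rho>) = complex_of_real e\<^sub>p"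
    using assms by (auto simp: bb84_states_def)
  have R: "\<rho> \<in> carrier_mat 4 4" using dens by (simp add: density_operator_def)
  obtain a b p r c q where ent: "\<rho> $$ (0, 0) = complex_of_real a" "\<rho> $$ (3, 3) = complex_of_real b" 
    "\<rho> $$ (0, 3) = c" "\<rho> $$ (3, 0) = cnj c" "\<rho> $$ (1, 1) = complex_of_real p" "\<rho> $$ (2, 2) = complex_of_real r" "\<rho> $$ (1, 2) = q" "\<rho> $$ (2, 1) = cnj q"
    and abc: "0 \<le> a" "0 \<le> b" "(cmod c)\<^sup>2 \<le> a * b" and prq: "0 \<le> p" "0 \<le> r" "(cmod q)\<^sup>2 \<le> p * r"
    and tr: "a + b + p + r = 1" using density_operator_4_entries[OF dens] .
  interpret two_qubit_entries \<rho> a b c p r q using R ent by unfold_locales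
  have "complex_of_real (p + r) = complex_of_real e\<^sub>b" using tb by (simp add: mat_trace_Pi_mult[OF R] ent ent[unfolded One_nat_def])
  then have eb: "e\<^sub>b = p + r" by (simp only: of_real_eq_iff)
  then have eb': "1 - e\<^sub>b = a + b" using tr by simp
  \<comment> \<open>As the total trace is 1, the phase error rate fixes the sum of the x
    components.\<close>
  have "Re (mat_trace (Pi_x_minus * \<rho>)) = (a + b + p + r - 2 * Re c - 2 * Re q) / 2"
    by (simp add: mat_trace_Pi_mult[OF R] ent ent[unfolded One_nat_def])
  then have ep: "2 * Re c + 2 * Re q = 1 - 2 * e\<^sub>p" using tp tr by simp
  show "sifted_randomness e\<^sub>b \<rho> = coherence (Phi \<rho>)"
    unfolding sifted_randomness_def eb' post_state_plus post_state_minus weighted_randomness[OF abc]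
      Phi_eq coherence_x_mat unfolding eb weighted_randomness[OF prq] ..
  show "1 - binary_entropy e\<^sub>p \<le> coherence (Phi \<rho>)"
    unfolding Phi_eq using coherence_x_mat_ge[OF abc prq tr ep] .
qed

text \<open>The Bell-diagonal state with independent bit and phase errors.\<close>

definition bell_state :: "real \<Rightarrow> real \<Rightarrow> complex mat" where
  "bell_state e\<^sub>b e\<^sub>p = x_mat ((1 - e\<^sub>b) / 2) ((1 - e\<^sub>b) / 2) (complex_of_real ((1 - e\<^sub>b) * (1 - 2 * e\<^sub>p) / 2))
     (e\<^sub>b / 2) (e\<^sub>b / 2) (complex_of_real (e\<^sub>b * (1 - 2 * e\<^sub>p) / 2))"

text \<open>\<open>Phi\<close> fixes the state, and its blocks contribute
  \<open>1 - binary_entropy e\<^sub>p\<close> with weights \<open>1 - e\<^sub>b\<close> and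
  \<open>e\<^sub>b\<close>. The determinant conditions follow from
  \<open>\<bar>1 - 2 * e\<^sub>p\<bar> \<le> 1\<close>.\<close>

lemma bell_state_optimal:
  assumes "0 \<le> e\<^sub>b" "e\<^sub>b \<le> 1" "0 \<le> e\<^sub>p" "e\<^sub>p \<le> 1"
  shows "bell_state e\<^sub>b e\<^sub>p \<in> bb84_states e\<^sub>b e\<^sub>p" "coherence (Phi (bell_state e\<^sub>b e\<^sub>p)) = 1 - binary_entropy e\<^sub>p"
proof -
  have minor: "(cmod (complex_of_real (w * (1 - 2 * e\<^sub>p) / 2)))\<^sup>2 \<le> w / 2 * (w / 2)" for w
  proof -
    have "\<bar>1 - 2 * e\<^sub>p\<bar> \<le> 1" using assms by (simp add: abs_le_iff)
    then have "(1 - 2 * e\<^sub>p)\<^sup>2 \<le> 1" using abs_le_square_iff[of "1 - 2 * e\<^sub>p" 1] by simp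
    then have "w\<^sup>2 * (1 - 2 * e\<^sub>p)\<^sup>2 \<le> w\<^sup>2 * 1" by (intro mult_left_mono) auto
    then show ?thesis
      unfolding norm_of_real power2_abs by (simp add: power_divide power2_eq_square ac_simps)
  qed
  have R: "bell_state e\<^sub>b e\<^sub>p \<in> carrier_mat 4 4" by (simp add: bell_state_def x_mat_def)
  have "density_operator 4 (bell_state e\<^sub>b e\<^sub>p)"
    unfolding bell_state_def using assms by (intro density_operator_x_mat minor) (auto simp: field_simps)
  then show "bell_state e\<^sub>b e\<^sub>p \<in> bb84_states e\<^sub>b e\<^sub>p"
    by (simp add: bb84_states_def mat_trace_Pi_mult[OF R])
      (simp add: bell_state_def x_mat_def field_simps)
  have "Phi (bell_state e\<^sub>b e\<^sub>p) = bell_state e\<^sub>b e\<^sub>p"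
    unfolding bell_state_def
    by (rule two_qubit_entries.Phi_eq) (unfold_locales, simp_all add: x_mat_def)
  then show "coherence (Phi (bell_state e\<^sub>b e\<^sub>p)) = 1 - binary_entropy e\<^sub>p"
    using assms by (simp add: bell_state_def coherence_x_mat block_coherence_symmetric del: of_real_divide of_real_mult of_real_diff)
      (simp add: algebra_simps)
qed

lemma minimumI:
  assumes "x \<in> A" "f x = m" "\<And>y. y \<in> A \<Longrightarrow> m \<le> f y"
  shows "has_minimum f A" "minimum f A = m"
  using assms by (auto simp: has_minimum_def minimum_def intro!: Least_equality)

text \<open>The \<open>has_minimum\<close> conjuncts make the two \<open>LEAST\<close> values
  genuine minima. The bounds on the error rates place \<open>bell_state\<close> in the set of
  states.\<close>

theorem corollary1:
  fixes e\<^sub>b e\<^sub>p :: real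
  assumes "0 \<le> e\<^sub>b" "e\<^sub>b \<le> 1" and "0 \<le> e\<^sub>p" "e\<^sub>p \<le> 1"
  shows "has_minimum (sifted_randomness e\<^sub>b) (bb84_states e\<^sub>b e\<^sub>p) \<and>
    has_minimum (\<lambda>\<rho>. coherence (Phi \<rho>)) (bb84_states e\<^sub>b e\<^sub>p) \<and>
    key_rate (bb84_states e\<^sub>b e\<^sub>p) e\<^sub>b
      = minimum (\<lambda>\<rho>. coherence (Phi \<rho>)) (bb84_states e\<^sub>b e\<^sub>p) - binary_entropy e\<^sub>b \<and>
    minimum (\<lambda>\<rho>. coherence (Phi \<rho>)) (bb84_states e\<^sub>b e\<^sub>p) - binary_entropy e\<^sub>b
      = 1 - binary_entropy e\<^sub>p - binary_entropy e\<^sub>b"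
proof -
  note opt = bell_state_optimal[OF assms]
  note C = minimumI[of _ _ "\<lambda>\<rho>. coherence (Phi \<rho>)", OF opt sifted_randomness_eq_coherence_Phi(2)]
  \<comment> \<open>The two objective functions agree on the set of states, so the same state
    minimizes both.\<close>
  have "sifted_randomness e\<^sub>b (bell_state e\<^sub>b e\<^sub>p) = 1 - binary_entropy e\<^sub>p"
    using sifted_randomness_eq_coherence_Phi(1)[OF opt(1)] opt(2) by simp
  moreover have "1 - binary_entropy e\<^sub>p \<le> sifted_randomness e\<^sub>b \<rho>" if "\<rho> \<in> bb84_states e\<^sub>b e\<^sub>p" for \<rho>
    using sifted_randomness_eq_coherence_Phi[OF that] by simp
  ultimately have "has_minimum (sifted_randomness e\<^sub>b) (bb84_states e\<^sub>b e\<^sub>p)"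
    "minimum (sifted_randomness e\<^sub>b) (bb84_states e\<^sub>b e\<^sub>p) = 1 - binary_entropy e\<^sub>p"
    using minimumI[OF opt(1)] by blast+
  then show ?thesis using C by (simp add: key_rate_def)
qed

end
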